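(* Let $q$ be a power of an odd prime with $q \equiv 3 \pmod 4$. For any positive integer $n$ satisfying $n^2 2^{2n-2} < q$ and arbitrary pairwise distinct $a_1, \ldots, a_n \in \mathbb{F}_q$, the directed graph $\mathcal{G}(X^2+a_1, \ldots, X^2+a_n)$ has a leaf.
   Context: $\mathbb{F}_q$ is the finite field of $q$ elements. For polynomials $f_1,\ldots,f_n \in \mathbb{F}_q[X]$, $\mathcal{G}(f_1,\ldots,f_n)$ is the directed graph with nodes labelled by the elements of $\mathbb{F}_q$ and with an edge from $u$ to $v$ ($u,v\in\mathbb{F}_q$) if and only if $f_i(u)=v$ for some $i=1,\ldots,n$. A leaf is a vertex of in-degree $0$. *)

theory Defs
  imports
    "HOL-Computational_Algebra.Polynomial"
    "HOL-Computational_Algebra.Primes"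
    "HOL-Number_Theory.Cong"
    "Graph_Theory.Digraph"
begin

text \<open>
  An arc is the pair of its end points, so there is at most one arc from \<open>u\<close> to \<open>v\<close>, even if
  several of the polynomials map \<open>u\<close> to \<open>v\<close>. Loops are allowed.
\<close>

definition poly_digraph ::
    "nat \<Rightarrow> (nat \<Rightarrow> 'a::{field,finite} poly) \<Rightarrow> ('a, 'a \<times> 'a) pre_digraph" where
  "poly_digraph n f =
     \<lparr> verts = UNIV,
       arcs = {(u, v). \<exists>i\<in>{1..n}. poly (f i) u = v},
       tail = fst,
       head = snd \<rparr>"

text \<open>
  \<^const>\<open>in_degree\<close> is a cardinality, which is 0 on infinite sets; the notion below is therefore
  only meaningful for graphs with finite in-degrees, such as those over a finite field.
\<close>

definition is_leaf :: "('a, 'b) pre_digraph \<Rightarrow> 'a \<Rightarrow> bool" where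
  "is_leaf G v \<longleftrightarrow> v \<in> verts G \<and> in_degree G v = 0"

end

theory Submission
  imports
    Defs
    "HOL-Computational_Algebra.Computational_Algebra"
    "HOL-Library.Cardinality"
    "HOL-Library.FuncSet"
begin

text \<open>
  A vertex \<open>v\<close> is a leaf iff no \<open>v - a\<^sub>i\<close> is a square, and this holds as soon as the quadratic
  character \<open>\<chi>\<close> of the field takes the value \<open>-1\<close> at every \<open>v - a\<^sub>i\<close>. Let \<open>A\<close> be the set of the
  \<open>a\<^sub>i\<close>. If there is no such \<open>v\<close>, then \<open>\<Prod>a\<in>A. 1 - \<chi>(v - a)\<close> is \<open>0\<close> for \<open>v \<notin> A\<close> and at most
  \<open>2^(n-1)\<close> for \<open>v \<in> A\<close>, so that its sum over \<open>v\<close> is at most \<open>n * 2^(n-1)\<close>. Expanding the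
  product over the subsets \<open>S\<close> of \<open>A\<close>, the empty set contributes \<open>q\<close> to this sum, and a nonempty \<open>S\<close>
  contributes at most \<open>(card S - 1) * sqrt q\<close> in absolute value by the Weil bound
  \<open>weil_bound_split_polynomial\<close>. The numbers \<open>card S - 1\<close> add up to less than \<open>n * 2^(n-1)\<close>,
  which is smaller than \<open>sqrt q\<close> by hypothesis: a contradiction (\<open>exists_nonsquare_shifts\<close>).

  The Weil bound is proved through an \<open>L\<close>-function, entirely inside \<open>F\<^sub>q[X]\<close>. Put
  \<open>f = (\<Prod>a\<in>A. X - a)\<close>. The function \<open>poly_char A\<close>, in essence \<open>g \<mapsto> \<chi>(\<Prod>a\<in>A. g(a))\<close>, is
  multiplicative on monic polynomials. Let \<open>c m\<close> be its sum over the monic polynomials of degree \<open>m\<close>.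
  Then \<open>c 1\<close> is the character sum to be bounded, and \<open>c m = 0\<close> for \<open>m \<ge> card A\<close>, because the
  values of a monic polynomial of such a degree at the points of \<open>A\<close> are independent of each other
  (\<open>sum_poly_char_eq_0\<close>). So \<open>\<Sum>m. c m T^m\<close> is a polynomial in \<open>T\<close> of degree less than \<open>card A\<close>. By unique
  factorization its logarithmic derivative is \<open>\<Sum>k. S k T^(k-1)\<close>, where \<open>S k\<close> is a sum over the prime
  powers of degree \<open>k\<close> (\<open>newton_identity\<close>). If \<open>\<bar>S k\<bar> \<le> C * sqrt q ^ k\<close>, this series converges for
  \<open>norm T < 1 / sqrt q\<close>, hence the polynomial has no zero there; and \<open>c 1\<close>, being minus the sum of the
  inverse zeros, is at most \<open>(card A - 1) * sqrt q\<close> in absolute value (\<open>linear_coeff_bound_of_newton\<close>).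

  Any constant \<open>C\<close> will do here, so a crude form of Stepanov's method is good enough. Let \<open>Q = q ^ k\<close>.
  For an irreducible \<open>\<pi>\<close> whose degree divides \<open>k\<close>, Euler's criterion (\<open>euler_criterion_poly\<close>) says
  that \<open>\<pi>\<close> contributes to \<open>S k\<close> its degree times the residue of \<open>f ^ ((Q - 1) div 2)\<close> modulo \<open>\<pi>\<close>. A nonzero
  polynomial of controlled degree that is divisible by \<open>\<pi> ^ l\<close> for all \<open>\<pi>\<close> with the same residue
  \<open>1\<close> or \<open>-1\<close> bounds the total degree of these \<open>\<pi>\<close> by \<open>Q / 2 + O(sqrt Q)\<close> (\<open>stepanov_bound\<close>). As all
  degrees together add up to \<open>Q\<close>, the residues \<open>1\<close> and \<open>-1\<close> nearly balance (\<open>prime_power_sum_bound\<close>).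
\<close>

section \<open>The Frobenius map on polynomials over a finite field\<close>

lemma field_power_card:
  fixes x :: "'a::{field,finite}"
  shows "x ^ CARD('a) = x"
proof (cases "x = 0")
  case True
  then show ?thesis by (simp add: power_0_left)
next
  case False
  let ?U = "UNIV - {0::'a}"
  have "bij_betw ((*) x) ?U ?U"
    by (rule bij_betw_byWitness[where f' = "\<lambda>y. y / x"]) (use False in auto)
  then have "(\<Prod>y\<in>?U. x * y) = \<Prod>?U"
    by (rule prod.reindex_bij_betw)
  moreover have "(\<Prod>y\<in>?U. x * y) = x ^ card ?U * \<Prod>?U"
    by (simp add: prod.distrib)
  ultimately have "x ^ card ?U = 1" by simp
  moreover have "CARD('a) = Suc (card ?U)"
    by (simp add: card_Diff_singleton_if)
  ultimately show ?thesis by (metis mult.right_neutral power_Suc)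
qed

lemma card_field_ge_2: "CARD('a::{field,finite}) \<ge> 2"
proof -
  have "card {0, 1::'a} \<le> CARD('a)" by (intro card_mono) auto
  then show ?thesis by simp
qed

text \<open>
  Both sides are monic of degree \<open>q\<close> and take the same values at all \<open>q\<close> points of the field.
  This form of the freshman's dream does not mention the characteristic.
\<close>

lemma linear_power_card:
  fixes c :: "'a::{field,finite}"
  shows "[:c, 1:] ^ CARD('a) = monom 1 CARD('a) + [:c:]"
proof (rule poly_eqI_degree_lead_coeff[where n = "CARD('a)" and A = UNIV])
  have *: "degree ([:c, 1:] ^ CARD('a)) = CARD('a)"
    by (simp add: degree_power_eq)
  have "coeff ([:c, 1:] ^ CARD('a)) CARD('a) = 1"
    using lead_coeff_power[of "[:c, 1:]" "CARD('a)"] * by simp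
  then show "coeff ([:c, 1:] ^ CARD('a)) CARD('a) = coeff (monom 1 CARD('a) + [:c:]) CARD('a)"
    using card_field_ge_2[where 'a='a] by (simp add: coeff_pCons split: nat.splits)
  show "degree ([:c, 1:] ^ CARD('a)) \<le> CARD('a)" by (simp add: *)
  show "degree (monom 1 CARD('a) + [:c:]) \<le> CARD('a)"
    by (intro degree_add_le) (simp_all add: degree_monom_le)
qed (simp_all add: poly_monom field_power_card)

lemma pcompose_power: "pcompose (p ^ n) q = pcompose p q ^ n"
  for p q :: "'a::comm_semiring_1 poly"
  by (induction n) (simp_all add: pcompose_mult pcompose_1)

lemma pcompose_monom: "pcompose (monom 1 n) q = q ^ n"
  for q :: "'a::comm_semiring_1 poly"
  by (simp add: monom_altdef pcompose_power pcompose_pCons)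

lemma power_card_eq_pcompose:
  fixes h :: "'a::{field,finite} poly"
  shows "h ^ CARD('a) = pcompose h (monom 1 CARD('a))"
proof (induction h)
  case 0
  then show ?case by (simp add: power_0_left)
next
  case (pCons c h)
  have "pcompose ([:c, 1:] ^ CARD('a)) (pCons 0 h) = pcompose (monom 1 CARD('a) + [:c:]) (pCons 0 h)"
    by (simp only: linear_power_card)
  then have "(pCons c h) ^ CARD('a) = (pCons 0 h) ^ CARD('a) + [:c:]"
    by (simp add: pcompose_power pcompose_add pcompose_pCons monom_altdef pcompose_mult)
  also have "(pCons 0 h) ^ CARD('a) = monom 1 CARD('a) * h ^ CARD('a)"
  proof -
    have "pCons 0 h = [:0, 1:] * h" by simp
    then show ?thesis by (simp only: power_mult_distrib monom_altdef smult_1_left)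
  qed
  finally show ?case using pCons.IH by (simp add: pcompose_pCons add.commute)
qed

lemma power_card_power_eq_pcompose:
  fixes h :: "'a::{field,finite} poly"
  shows "h ^ (CARD('a) ^ k) = pcompose h (monom 1 (CARD('a) ^ k))"
proof (induction k)
  case 0
  then show ?case by (simp add: monom_altdef)
next
  case (Suc k)
  have "h ^ (CARD('a) ^ Suc k) = (h ^ (CARD('a) ^ k)) ^ CARD('a)"
    by (simp add: power_mult mult.commute flip: power_mult)
  also have "\<dots> = pcompose (pcompose h (monom 1 (CARD('a) ^ k))) (monom 1 CARD('a))"
    by (simp add: Suc power_card_eq_pcompose)
  also have "\<dots> = pcompose h (monom 1 (CARD('a) ^ k * CARD('a)))"
    by (simp add: pcompose_assoc[symmetric] pcompose_monom monom_power mult.commute)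
  finally show ?case by (simp add: mult.commute)
qed

lemma poly_power_card_add:
  fixes g h :: "'a::{field,finite} poly"
  shows "(g + h) ^ (CARD('a) ^ k) = g ^ (CARD('a) ^ k) + h ^ (CARD('a) ^ k)"
  by (simp add: power_card_power_eq_pcompose pcompose_add)

definition polys_below :: "nat \<Rightarrow> 'a::zero poly set" where
  "polys_below n = {h. \<forall>i\<ge>n. coeff h i = 0}"

lemma polys_below_eq: "polys_below n = {h. h = 0 \<or> degree h < n}"
  unfolding polys_below_def
  by (auto simp: coeff_eq_0 leading_coeff_0_iff) (metis leading_coeff_0_iff not_less)

lemma card_polys_below:
  "finite (polys_below n :: 'a::{zero,finite} poly set)"
  "card (polys_below n :: 'a poly set) = CARD('a) ^ n"
proof -
  have "finite (polys_below n :: 'a poly set) \<and> card (polys_below n :: 'a poly set) = CARD('a) ^ n"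
  proof (induction n)
    case 0
    have "polys_below 0 = {0 :: 'a poly}"
      by (auto simp: polys_below_def poly_eq_iff)
    then show ?case by simp
  next
    case (Suc n)
    have eq: "polys_below (Suc n) = (\<lambda>(c, h). pCons c h) ` ((UNIV :: 'a set) \<times> polys_below n)"
    proof (intro equalityI subsetI)
      fix h :: "'a poly" assume h: "h \<in> polys_below (Suc n)"
      obtain c h' where "h = pCons c h'" by (rule pCons_cases)
      with h show "h \<in> (\<lambda>(c, h). pCons c h) ` (UNIV \<times> polys_below n)"
        by (force simp: polys_below_def)
    next
      fix h :: "'a poly" assume "h \<in> (\<lambda>(c, h). pCons c h) ` (UNIV \<times> polys_below n)"
      then show "h \<in> polys_below (Suc n)"
        by (auto simp: polys_below_def coeff_pCons split: nat.splits)
    qed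
    have "inj_on (\<lambda>(c, h). pCons c h) ((UNIV :: 'a set) \<times> polys_below n)"
      by (auto simp: inj_on_def)
    then show ?case using Suc by (simp add: eq card_image card_cartesian_product)
  qed
  then show "finite (polys_below n :: 'a poly set)" "card (polys_below n :: 'a poly set) = CARD('a) ^ n"
    by auto
qed

lemma prime_elem_dvd_prod:
  assumes "prime_elem p" "p dvd (\<Prod>x\<in>A. f x)"
  shows "\<exists>x\<in>A. p dvd f x"
  using assms(2)
proof (induction A rule: infinite_finite_induct)
  case (insert x A)
  then show ?case using assms(1) by (auto simp: prime_elem_dvd_mult_iff)
qed (use assms(1) in \<open>auto simp: prime_elem_def\<close>)

lemma irreducible_poly_degree_pos:
  fixes \<pi> :: "'a::field poly"
  assumes "irreducible \<pi>" shows "degree \<pi> > 0"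
proof (rule ccontr)
  assume "\<not> degree \<pi> > 0"
  then have "is_unit \<pi>" using assms by (auto simp: is_unit_iff_degree irreducible_def)
  with assms show False by (auto simp: irreducible_def)
qed

text \<open>
  Multiplication by \<open>g\<close> permutes the nonzero residues modulo \<open>\<pi>\<close>; compare the products of all
  residues before and after.
\<close>

lemma fermat_little_poly:
  fixes \<pi> g :: "'a::{field,finite} poly"
  assumes irr: "irreducible \<pi>" and ndvd: "\<not> \<pi> dvd g"
  shows "[g ^ (CARD('a) ^ degree \<pi> - 1) = 1] (mod \<pi>)"
proof -
  have prime: "prime_elem \<pi>" using irr by (rule field_poly_irreducible_imp_prime)
  have pi0: "\<pi> \<noteq> 0" using irr by auto
  define U where "U = polys_below (degree \<pi>) - {0 :: 'a poly}"
  have U: "h \<in> U \<longleftrightarrow> h \<noteq> 0 \<and> degree h < degree \<pi>" for h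
    by (auto simp: U_def polys_below_eq)
  have finU: "finite U" by (simp add: U_def card_polys_below)
  have cardU: "card U = CARD('a) ^ degree \<pi> - 1"
  proof -
    have "(0 :: 'a poly) \<in> polys_below (degree \<pi>)" by (simp add: polys_below_def)
    then show ?thesis by (simp add: U_def card_Diff_singleton card_polys_below)
  qed
  have ndvdU: "\<not> \<pi> dvd h" if "h \<in> U" for h
    using that dvd_imp_degree_le[of \<pi> h] by (auto simp: U)
  have inU: "(g * h) mod \<pi> \<in> U" if "h \<in> U" for h
  proof -
    have "\<not> \<pi> dvd g * h" using ndvd ndvdU[OF that] prime by (simp add: prime_elem_dvd_mult_iff)
    then have "(g * h) mod \<pi> \<noteq> 0" by (simp add: mod_eq_0_iff_dvd)
    then show ?thesis using degree_mod_less[OF pi0, of "g * h"] by (auto simp: U)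
  qed
  have inj: "inj_on (\<lambda>h. (g * h) mod \<pi>) U"
  proof (rule inj_onI)
    fix h h' assume h: "h \<in> U" "h' \<in> U" and eq: "(g * h) mod \<pi> = (g * h') mod \<pi>"
    then have "\<pi> dvd g * (h - h')"
      by (simp add: mod_eq_dvd_iff right_diff_distrib)
    then have "\<pi> dvd h - h'" using ndvd prime by (simp add: prime_elem_dvd_mult_iff)
    moreover have "degree (h - h') < degree \<pi>"
      using h by (auto simp: U intro: degree_diff_less)
    ultimately show "h = h'"
      using dvd_imp_degree_le[of \<pi> "h - h'"] by force
  qed
  have "(\<lambda>h. (g * h) mod \<pi>) ` U = U"
    by (rule endo_inj_surj) (use finU inU inj in auto)
  then have bij: "bij_betw (\<lambda>h. (g * h) mod \<pi>) U U" using inj by (simp add: bij_betw_def)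
  have "[(\<Prod>h\<in>U. g * h) = (\<Prod>h\<in>U. (g * h) mod \<pi>)] (mod \<pi>)"
    by (intro cong_prod) (simp add: cong_def)
  also have "(\<Prod>h\<in>U. (g * h) mod \<pi>) = \<Prod>U" using bij by (rule prod.reindex_bij_betw)
  finally have "[g ^ card U * \<Prod>U = \<Prod>U] (mod \<pi>)" by (simp add: prod.distrib)
  then have "\<pi> dvd (g ^ card U - 1) * \<Prod>U"
    by (simp add: cong_iff_dvd_diff left_diff_distrib)
  moreover have "\<not> \<pi> dvd \<Prod>U"
    using prime_elem_dvd_prod[OF prime, of id U] ndvdU by auto
  ultimately have "\<pi> dvd g ^ card U - 1" using prime by (simp add: prime_elem_dvd_mult_iff)
  then show ?thesis by (simp add: cong_iff_dvd_diff cardU)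
qed

lemma cong_power_card_degree:
  fixes \<pi> g :: "'a::{field,finite} poly"
  assumes irr: "irreducible \<pi>" and k: "degree \<pi> dvd k"
  shows "[g ^ (CARD('a) ^ k) = g] (mod \<pi>)"
proof -
  have *: "[g ^ (CARD('a) ^ degree \<pi>) = g] (mod \<pi>)" for g
  proof (cases "\<pi> dvd g")
    case True
    have "\<pi> dvd g ^ (CARD('a) ^ degree \<pi>)"
      using True by (meson dvd_power dvd_trans finite_UNIV_card_ge_0 finite zero_less_power)
    with True show ?thesis by (simp add: cong_iff_dvd_diff)
  next
    case False
    have "Suc (CARD('a) ^ degree \<pi> - 1) = CARD('a) ^ degree \<pi>" by simp
    then have "g ^ (CARD('a) ^ degree \<pi>) = g ^ (CARD('a) ^ degree \<pi> - 1) * g"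
      by (metis power_Suc2)
    with cong_mult[OF fermat_little_poly[OF irr False] cong_refl, of g] show ?thesis by simp
  qed
  obtain j where j: "k = degree \<pi> * j" using k by (elim dvdE)
  have "[g ^ ((CARD('a) ^ degree \<pi>) ^ j) = g] (mod \<pi>)"
  proof (induction j)
    case (Suc j)
    have "[(g ^ ((CARD('a) ^ degree \<pi>) ^ j)) ^ (CARD('a) ^ degree \<pi>) = g ^ ((CARD('a) ^ degree \<pi>) ^ j)] (mod \<pi>)"
      by (rule *)
    from cong_trans[OF this Suc] show ?case by (simp add: mult.commute flip: power_mult)
  qed simp
  then show ?thesis by (simp add: j power_mult)
qed

lemma prod_linear_eq:
  "(\<Prod>c\<in>UNIV. [:-c, 1:]) = monom 1 CARD('a) - [:0, 1 :: 'a::{field,finite}:]"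
proof (rule poly_eqI_degree_lead_coeff[where n = "CARD('a)" and A = UNIV])
  have *: "degree (\<Prod>c\<in>(UNIV::'a set). [:-c, 1:]) = CARD('a)"
    by (subst degree_prod_eq_sum_degree) auto
  have "coeff (\<Prod>c\<in>(UNIV::'a set). [:-c, 1:]) CARD('a) = 1"
    using lead_coeff_prod[of "\<lambda>c. [:-c, 1:]" "UNIV::'a set"] * by simp
  then show "coeff (\<Prod>c\<in>(UNIV::'a set). [:-c, 1:]) CARD('a) = coeff (monom 1 CARD('a) - [:0, 1 :: 'a:]) CARD('a)"
    using card_field_ge_2[where 'a='a] by (auto simp: coeff_pCons split: nat.splits)
  show "degree (\<Prod>c\<in>(UNIV::'a set). [:-c, 1:]) \<le> CARD('a)" by (simp add: *)
  show "degree (monom 1 CARD('a) - [:0, 1 :: 'a:]) \<le> CARD('a)"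
    using card_field_ge_2[where 'a='a] by (intro degree_diff_le) (simp_all add: degree_monom_le)
qed (auto simp: poly_monom poly_prod field_power_card)

text \<open>
  \<open>b ^ q - b\<close> factors into the polynomials \<open>b - c\<close> for \<open>c\<close> in the field, and the prime \<open>\<pi>\<close> divides
  one of the factors.
\<close>

lemma frobenius_fixed_imp_const:
  fixes \<pi> b :: "'a::{field,finite} poly"
  assumes irr: "irreducible \<pi>" and "[b ^ CARD('a) = b] (mod \<pi>)"
  shows "\<exists>c. [b = [:c:]] (mod \<pi>)"
proof -
  have prime: "prime_elem \<pi>" using irr by (rule field_poly_irreducible_imp_prime)
  have "pcompose (\<Prod>c\<in>UNIV. [:-c, 1:]) b = pcompose (monom 1 CARD('a) - [:0, 1 :: 'a:]) b"
    by (simp only: prod_linear_eq)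
  moreover have "[:-c:] + b = b - [:c:]" for c by simp
  ultimately have "(\<Prod>c\<in>UNIV. b - [:c:]) = b ^ CARD('a) - b"
    by (simp add: pcompose_prod pcompose_diff pcompose_pCons monom_altdef pcompose_power minus_pCons)
  then have "\<pi> dvd (\<Prod>c\<in>UNIV. b - [:c:])" using assms(2) by (simp add: cong_iff_dvd_diff)
  then obtain c where "\<pi> dvd b - [:c:]" using prime_elem_dvd_prod[OF prime] by blast
  then show ?thesis by (auto simp: cong_iff_dvd_diff)
qed

section \<open>Euler's criterion modulo an irreducible polynomial\<close>

text \<open>
  The coefficients are polynomials in \<open>X\<close>: the Frobenius map sends the roots \<open>X^(q^j)\<close> of a product of
  linear factors to \<open>X^(q^(j+1))\<close>, hence acts on the coefficients as well.
\<close>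

lemma coeff_prod_linear_frobenius:
  "coeff (\<Prod>j<n. [:- monom 1 (CARD('a) ^ Suc j), 1:]) i
     = coeff (\<Prod>j<n. [:- monom (1 :: 'a::{field,finite}) (CARD('a) ^ j), 1:]) i ^ CARD('a)"
proof (induction n arbitrary: i)
  case 0
  have "0 ^ CARD('a) = (0 :: 'a poly)" by (simp add: power_0_left)
  then show ?case by (cases i) (simp_all add: coeff_1)
next
  case (Suc n)
  have add: "(x + y) ^ CARD('a) = x ^ CARD('a) + y ^ CARD('a)" for x y :: "'a poly"
    using poly_power_card_add[of x y 1] by simp
  have uminus: "(- x) ^ CARD('a) = - (x ^ CARD('a))" for x :: "'a poly"
    by (simp add: power_card_eq_pcompose pcompose_uminus)
  have monom: "monom (1::'a) (CARD('a) ^ j) ^ CARD('a) = monom 1 (CARD('a) ^ Suc j)" for j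
    by (simp add: monom_power mult.commute)
  have zero: "0 ^ CARD('a) = (0 :: 'a poly)" by (simp add: power_0_left)
  have step: "coeff (p * [:b, 1:]) i = b * coeff p i + (if i = 0 then 0 else coeff p (i - 1))"
    for p :: "'a poly poly" and b
    by (cases i) (simp_all add: mult_pCons_right coeff_pCons)
  show ?case
    by (simp only: prod.lessThan_Suc step Suc.IH add power_mult_distrib uminus monom zero if_distrib[of "\<lambda>x. x ^ CARD('a)"])
qed

text \<open>
  In the residue field of \<open>\<pi>\<close> the conjugates of the root \<open>X\<close> are the powers \<open>X^(q^j)\<close>, so \<open>\<pi>\<close> is the
  product \<open>\<Phi>\<close> of the factors \<open>T - X^(q^j)\<close>. To stay within polynomials, this is derived modulo \<open>\<pi>\<close>: the
  Frobenius map permutes the factors of \<open>\<Phi>\<close> cyclically, so it fixes the coefficients of \<open>\<Phi>\<close>, which are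
  therefore constants modulo \<open>\<pi>\<close>. These constants form a monic polynomial \<open>\<rho>\<close> of the degree of
  \<open>\<pi>\<close> that vanishes at \<open>X\<close> modulo \<open>\<pi>\<close>, which means \<open>\<pi> dvd \<rho>\<close>.
\<close>

lemma prod_diff_frobenius_cong:
  fixes \<pi> :: "'a::{field,finite} poly"
  assumes irr: "irreducible \<pi>" and monic: "lead_coeff \<pi> = 1"
  shows "[(\<Prod>j<degree \<pi>. [:a:] - monom 1 (CARD('a) ^ j)) = [:poly \<pi> a:]] (mod \<pi>)"
proof -
  define e where "e = degree \<pi>"
  have prime: "prime_elem \<pi>" using irr by (rule field_poly_irreducible_imp_prime)
  have e: "e > 0" using irreducible_poly_degree_pos[OF irr] by (simp add: e_def)
  define \<Phi> where "\<Phi> = (\<Prod>j<e. [:- monom (1::'a) (CARD('a) ^ j), 1:])"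
  define \<Psi> where "\<Psi> = (\<Prod>j<e. [:- monom (1::'a) (CARD('a) ^ Suc j), 1:])"
  \<comment> \<open>Both sides are the product of the factors for \<open>j \<le> e\<close>; as \<open>X^(q^e) = X\<close> modulo \<open>\<pi>\<close>, cancelling yields \<open>\<Phi> = \<Psi>\<close> modulo \<open>\<pi>\<close>.\<close>
  have "\<Phi> * [:- monom 1 (CARD('a) ^ e), 1:] = [:- monom 1 1, 1:] * \<Psi>"
    using prod.lessThan_Suc[of "\<lambda>j. [:- monom (1::'a) (CARD('a) ^ j), 1:]" e]
      prod.lessThan_Suc_shift[of "\<lambda>j. [:- monom (1::'a) (CARD('a) ^ j), 1:]" e]
    unfolding \<Phi>_def \<Psi>_def by simp
  moreover have "[:- monom (1::'a) (CARD('a) ^ e), 1:] = [:- monom 1 1, 1:] - [:monom 1 (CARD('a) ^ e) - monom 1 1:]"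
    by simp
  ultimately have "(\<Psi> - \<Phi>) * [:- monom 1 1, 1:] = [:monom 1 (CARD('a) ^ e) - monom 1 1:] * (- \<Phi>)"
    by (simp only: ring_distribs mult.commute) (simp add: algebra_simps)
  moreover have "\<pi> dvd monom 1 (CARD('a) ^ e) - monom 1 1"
    using cong_power_card_degree[OF irr, of e "monom 1 1"] by (simp add: e_def monom_power cong_iff_dvd_diff)
  ultimately have "[:\<pi>:] dvd (\<Psi> - \<Phi>) * [:- monom 1 1, 1:]"
    by (simp only:) (intro dvd_mult2, simp)
  moreover have "\<not> [:\<pi>:] dvd [:- monom 1 1, 1:]"
  proof
    assume "[:\<pi>:] dvd [:- monom 1 1, 1:]"
    then have "\<pi> dvd coeff [:- monom 1 1, 1:] 1" by (simp only: const_poly_dvd_iff)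
    then show False using irr by (auto simp: irreducible_def)
  qed
  ultimately have "[:\<pi>:] dvd \<Psi> - \<Phi>"
    using lift_prime_elem_poly[OF prime] by (simp only: prime_elem_dvd_mult_iff simp_thms)
  then have "\<pi> dvd coeff (\<Psi> - \<Phi>) i" for i by (simp only: const_poly_dvd_iff)
  moreover have "coeff \<Psi> i = coeff \<Phi> i ^ CARD('a)" for i
    unfolding \<Phi>_def \<Psi>_def by (rule coeff_prod_linear_frobenius)
  ultimately have "\<exists>c. [coeff \<Phi> i = [:c:]] (mod \<pi>)" for i
    by (intro frobenius_fixed_imp_const irr) (metis coeff_diff cong_iff_dvd_diff)
  then obtain c' where c': "[coeff \<Phi> i = [:c' i:]] (mod \<pi>)" for i by metis
  define c where "c = c'(e := 1)"
  have deg\<Phi>: "degree \<Phi> = e" unfolding \<Phi>_def by (subst degree_prod_eq_sum_degree) auto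
  have "lead_coeff \<Phi> = 1" unfolding \<Phi>_def by (subst lead_coeff_prod) auto
  then have c: "[coeff \<Phi> i = [:c i:]] (mod \<pi>)" for i
    using c' deg\<Phi> by (simp add: c_def one_pCons)
  have eval: "[poly \<Phi> t = (\<Sum>i\<le>e. [:c i:] * t ^ i)] (mod \<pi>)" for t
    unfolding poly_altdef deg\<Phi> by (intro cong_sum cong_mult c cong_refl)
  define \<rho> where "\<rho> = (\<Sum>i\<le>e. monom (c i) i)"
  have \<rho>: "poly \<rho> x = (\<Sum>i\<le>e. c i * x ^ i)" for x
    by (simp add: \<rho>_def poly_sum poly_monom)
  have coeff\<rho>: "coeff \<rho> i = (if i \<le> e then c i else 0)" for i
    by (simp add: \<rho>_def coeff_sum)
  have deg\<rho>: "degree \<rho> = e"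
    by (rule antisym) (auto simp: coeff\<rho> c_def intro!: degree_le le_degree)
  have "poly \<Phi> (monom 1 1) = 0"
    using e unfolding \<Phi>_def poly_prod by (auto intro!: bexI[of _ 0])
  moreover have "(\<Sum>i\<le>e. [:c i:] * monom 1 1 ^ i) = \<rho>"
    unfolding \<rho>_def by (intro sum.cong refl) (simp add: monom_power smult_monom)
  ultimately have "\<pi> dvd \<rho>" using eval[of "monom 1 1"] by (simp add: cong_iff_dvd_diff)
  then obtain t where t: "\<rho> = \<pi> * t" by (elim dvdE)
  have "\<rho> \<noteq> 0" using coeff\<rho>[of e] by (auto simp: c_def)
  then have "degree t = 0" using t deg\<rho> by (auto simp: degree_mult_eq e_def)
  then obtain u where u: "t = [:u:]" by (auto elim: degree_eq_zeroE)
  have "lead_coeff \<rho> = 1" by (simp add: deg\<rho> coeff\<rho> c_def)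
  then have "lead_coeff \<pi> * lead_coeff t = 1" unfolding t lead_coeff_mult .
  then have "u = 1" unfolding monic u by simp
  then have "\<rho> = \<pi>" using t u by simp
  moreover have "(\<Sum>i\<le>e. [:c i:] * [:a:] ^ i) = [:poly \<rho> a:]"
    unfolding \<rho> by (induction e) (simp_all add: poly_const_pow)
  moreover have "poly \<Phi> [:a:] = (\<Prod>j<e. [:a:] - monom 1 (CARD('a) ^ j))"
    unfolding \<Phi>_def poly_prod by (intro prod.cong) auto
  ultimately show ?thesis using eval[of "[:a:]"] by (simp add: e_def)
qed

text \<open>
  The left-hand side is the norm of \<open>X - a\<close> from the residue field of \<open>\<pi>\<close> to the base field. This is
  the reciprocity law between \<open>X - a\<close> and \<open>\<pi>\<close>.
\<close>

lemma linear_norm_cong: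
  fixes \<pi> :: "'a::{field,finite} poly"
  assumes irr: "irreducible \<pi>" and monic: "lead_coeff \<pi> = 1"
  shows "[[:-a, 1:] ^ (\<Sum>j<degree \<pi>. CARD('a) ^ j) = [:(-1) ^ degree \<pi> * poly \<pi> a:]] (mod \<pi>)"
proof -
  have "[:-a, 1:] ^ (CARD('a) ^ j) = (-1) * ([:a:] - monom 1 (CARD('a) ^ j))" for j
    by (simp add: power_card_power_eq_pcompose pcompose_pCons)
  then have "[:-a, 1:] ^ (\<Sum>j<degree \<pi>. CARD('a) ^ j)
      = (-1) ^ degree \<pi> * (\<Prod>j<degree \<pi>. [:a:] - monom 1 (CARD('a) ^ j))"
    unfolding power_sum by (simp only: prod.distrib) simp
  also have "[\<dots> = (-1) ^ degree \<pi> * [:poly \<pi> a:]] (mod \<pi>)"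
    by (intro cong_mult cong_refl prod_diff_frobenius_cong assms)
  also have "(-1) ^ degree \<pi> * [:poly \<pi> a:] = [:(-1) ^ degree \<pi> * poly \<pi> a:]"
    by (cases "even (degree \<pi>)") simp_all
  finally show ?thesis .
qed

text \<open>
  Defining the character by the power \<open>(q - 1) div 2\<close> rather than by the existence of square roots
  makes it multiplicative at once, and the leaves only need that a square never has the value \<open>-1\<close>.
\<close>

definition quad_char :: "'a::{field,finite} \<Rightarrow> int" where
  "quad_char x = (if x = 0 then 0 else if x ^ ((CARD('a) - 1) div 2) = 1 then 1 else -1)"

lemma quad_char_0 [simp]: "quad_char 0 = 0" and quad_char_1 [simp]: "quad_char 1 = 1"
  by (simp_all add: quad_char_def)

lemma quad_char_cases: "quad_char x \<in> {-1, 0, 1}" and quad_char_eq_0_iff [simp]: "quad_char x = 0 \<longleftrightarrow> x = 0"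
  by (auto simp: quad_char_def)

lemma field_power_card_minus_1:
  fixes x :: "'a::{field,finite}"
  assumes "x \<noteq> 0" shows "x ^ (CARD('a) - 1) = 1"
proof -
  have "x ^ CARD('a) = x ^ (CARD('a) - 1) * x"
    using card_field_ge_2[where 'a='a] by (metis Suc_diff_1 finite_UNIV_card_ge_0 finite power_Suc2)
  with assms show ?thesis by (simp add: field_power_card)
qed

lemma field_power_half:
  fixes x :: "'a::{field,finite}"
  assumes "odd CARD('a)" "x \<noteq> 0"
  shows "x ^ ((CARD('a) - 1) div 2) = 1 \<or> x ^ ((CARD('a) - 1) div 2) = -1"
proof -
  have "(x ^ ((CARD('a) - 1) div 2))\<^sup>2 = 1"
    using assms field_power_card_minus_1[of x] by (simp add: mult.commute flip: power_mult)
  then show ?thesis by (simp add: power2_eq_1_iff)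
qed

text \<open>
  Otherwise \<open>X^((q-1)/2) - 1\<close> would have \<open>q - 1\<close> roots.
\<close>

lemma quad_char_nonresidue:
  assumes odd: "odd CARD('a::{field,finite})"
  shows "\<exists>c::'a. quad_char c = -1"
proof (rule ccontr)
  assume "\<nexists>c::'a. quad_char c = -1"
  then have "x ^ ((CARD('a) - 1) div 2) = 1" if "x \<noteq> 0" for x :: 'a
    using that by (metis quad_char_def)
  moreover define h where "h = (CARD('a) - 1) div 2"
  ultimately have *: "x ^ h = 1" if "x \<noteq> 0" for x :: 'a
    using that by simp
  have q: "CARD('a) = 2 * h + 1" using odd by (auto simp: h_def elim: oddE)
  have h: "h > 0" using q card_field_ge_2[where 'a='a] by auto
  have deg: "degree (monom 1 h - 1 :: 'a poly) \<le> h"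
    by (intro degree_diff_le) (simp_all add: degree_monom_le)
  have "coeff (monom 1 h - 1 :: 'a poly) h = 1" using h by (simp add: coeff_1)
  then have nz: "(monom 1 h - 1 :: 'a poly) \<noteq> 0" by (metis coeff_0 zero_neq_one)
  have "card (UNIV - {0::'a}) \<le> card {x. poly (monom 1 h - 1 :: 'a poly) x = 0}"
    by (intro card_mono) (auto simp: poly_monom *)
  also have "\<dots> \<le> h" using card_poly_roots_bound[OF nz] deg by simp
  finally show False using q h by (simp add: card_Diff_singleton_if)
qed

lemma one_neq_minus_one:
  assumes "odd CARD('a::{field,finite})"
  shows "(1 :: 'a) \<noteq> -1"
proof -
  obtain c :: 'a where c: "quad_char c = -1" using quad_char_nonresidue[OF assms] by blast
  then have "c \<noteq> 0" "c ^ ((CARD('a) - 1) div 2) \<noteq> 1"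
    by (auto simp: quad_char_def split: if_splits)
  with field_power_half[OF assms, of c] show ?thesis by metis
qed

lemma power_half_eq_quad_char:
  fixes x :: "'a::{field,finite}"
  assumes "odd CARD('a)"
  shows "x ^ ((CARD('a) - 1) div 2) = of_int (quad_char x)"
proof (cases "x = 0")
  case True
  have "(CARD('a) - 1) div 2 > 0" using assms card_field_ge_2[where 'a='a] by (auto elim: oddE)
  with True show ?thesis by simp
next
  case False
  with field_power_half[OF assms False] show ?thesis by (auto simp: quad_char_def)
qed

lemma quad_char_mult:
  fixes x y :: "'a::{field,finite}"
  assumes "odd CARD('a)"
  shows "quad_char (x * y) = quad_char x * quad_char y"
proof (cases "x = 0 \<or> y = 0")
  case False
  then show ?thesis
    using field_power_half[OF assms, of x] field_power_half[OF assms, of y] one_neq_minus_one[OF assms]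
    by (auto simp: quad_char_def power_mult_distrib)
qed auto

lemma quad_char_square:
  fixes x :: "'a::{field,finite}"
  assumes "odd CARD('a)"
  shows "quad_char (x ^ 2) \<noteq> -1"
  using quad_char_cases[of x] by (auto simp: power2_eq_square quad_char_mult[OF assms])

text \<open>
  For monic \<open>g\<close>, the argument of \<open>quad_char\<close> is the product of \<open>t - a\<close> over the roots \<open>t\<close> of \<open>g\<close> in a
  splitting field. So it is \<open>v - a\<close> for \<open>g = X - v\<close>, and a norm for irreducible \<open>g\<close>.
\<close>

definition poly_char :: "'a::{field,finite} set \<Rightarrow> 'a poly \<Rightarrow> int" where
  "poly_char A g = (\<Prod>a\<in>A. quad_char ((-1) ^ degree g * poly g a))"

lemma poly_char_cases: "poly_char A g \<in> {-1, 0, 1}"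
  unfolding poly_char_def
proof (induction A rule: infinite_finite_induct)
  case (insert a A)
  then show ?case using quad_char_cases[of "(-1) ^ degree g * poly g a"] by auto
qed auto

lemma sum_powers_times: "(q - 1) * (\<Sum>j<n. q ^ j) = q ^ n - (1::nat)"
proof (cases "q = 0")
  case True
  then show ?thesis by (cases n) (simp_all add: sum.lessThan_Suc_shift power_0_left)
next
  case False
  then obtain m where q: "q = Suc m" by (cases q) auto
  have "m * (\<Sum>j<n. q ^ j) + 1 = q ^ n"
    by (induction n) (auto simp: q algebra_simps)
  then show ?thesis using q by simp
qed

text \<open>
  The exponent splits as \<open>N * ((q - 1) div 2) * M\<close>: the power \<open>N\<close> is the norm to the base field, where
  the power \<open>(q - 1) div 2\<close> is the quadratic character, and \<open>M\<close> has the parity of \<open>r\<close>.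
\<close>

lemma euler_criterion_poly:
  fixes \<pi> :: "'a::{field,finite} poly"
  assumes odd: "odd CARD('a)" and irr: "irreducible \<pi>" and monic: "lead_coeff \<pi> = 1"
    and k: "k = degree \<pi> * r" "r > 0"
  shows "[(\<Prod>a\<in>A. [:-a, 1:]) ^ ((CARD('a) ^ k - 1) div 2) = of_int (poly_char A \<pi> ^ r)] (mod \<pi>)"
proof -
  define q where "q = CARD('a)"
  define e where "e = degree \<pi>"
  define N where "N = (\<Sum>j<e. q ^ j)"
  define M where "M = (\<Sum>j<r. (q ^ e) ^ j)"
  have "(q - 1) * N = q ^ e - 1" "(q ^ e - 1) * M = q ^ k - 1"
    using sum_powers_times[of q e] sum_powers_times[of "q ^ e" r] by (simp_all add: N_def M_def k e_def power_mult)
  then have "2 * ((q - 1) div 2 * N * M) = q ^ k - 1"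
    using odd by (simp add: q_def mult.assoc[symmetric])
  then have expo: "(q ^ k - 1) div 2 = N * ((q - 1) div 2) * M" by (simp add: mult_ac)
  have parity: "even M \<longleftrightarrow> even r"
    using odd by (simp add: M_def q_def even_sum_iff)
  have "M > 0" using k(2) by (auto simp: M_def q_def intro!: sum_pos)
  then have pow: "poly_char A \<pi> ^ M = poly_char A \<pi> ^ r"
    using poly_char_cases[of A \<pi>] parity k(2) by (auto simp: power_0_left minus_one_power_iff)
  have "(\<Prod>a\<in>A. [:-a, 1:]) ^ N = (\<Prod>a\<in>A. [:-a, 1:] ^ N)" by (rule prod_power_distrib)
  also have "[\<dots> = (\<Prod>a\<in>A. [:(-1) ^ e * poly \<pi> a:])] (mod \<pi>)"
    unfolding N_def q_def e_def by (intro cong_prod linear_norm_cong irr monic)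
  finally have "[((\<Prod>a\<in>A. [:-a, 1:]) ^ N) ^ ((q - 1) div 2)
      = (\<Prod>a\<in>A. [:(-1) ^ e * poly \<pi> a:]) ^ ((q - 1) div 2)] (mod \<pi>)"
    by (rule cong_pow)
  also have "(\<Prod>a\<in>A. [:(-1) ^ e * poly \<pi> a:]) ^ ((q - 1) div 2)
      = (\<Prod>a\<in>A. [:of_int (quad_char ((-1) ^ e * poly \<pi> a)):])"
    unfolding prod_power_distrib by (simp only: poly_const_pow power_half_eq_quad_char[OF odd] q_def)
  also have "\<dots> = of_int (poly_char A \<pi>)"
  proof -
    have "(\<Prod>a\<in>A. [:f a:]) = [:\<Prod>a\<in>A. f a:]" for f :: "'a \<Rightarrow> 'a"
      by (induction A rule: infinite_finite_induct) auto
    then show ?thesis by (simp add: poly_char_def e_def of_int_poly)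
  qed
  finally have "[(((\<Prod>a\<in>A. [:-a, 1:]) ^ N) ^ ((q - 1) div 2)) ^ M = of_int (poly_char A \<pi>) ^ M] (mod \<pi>)"
    by (rule cong_pow)
  then show ?thesis unfolding q_def[symmetric] expo by (simp add: power_mult pow flip: of_int_power)
qed

section \<open>Character sums over monic polynomials\<close>

definition monics :: "nat \<Rightarrow> 'a::field poly set" where
  "monics m = {g. lead_coeff g = 1 \<and> degree g = m}"

lemma monics_eq: "monics m = (\<lambda>h. monom 1 m + h) ` (polys_below m :: 'a::field poly set)"
proof (intro equalityI subsetI)
  fix g :: "'a poly" assume g: "g \<in> monics m"
  then have "g - monom 1 m \<in> polys_below m"
    by (auto simp: monics_def polys_below_def coeff_eq_0)
  then show "g \<in> (\<lambda>h. monom 1 m + h) ` polys_below m"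
    by (intro image_eqI[of _ _ "g - monom 1 m"]) auto
next
  fix g :: "'a poly" assume "g \<in> (\<lambda>h. monom 1 m + h) ` polys_below m"
  then obtain h where g: "g = monom 1 m + h" and h: "\<forall>i\<ge>m. coeff h i = 0"
    by (auto simp: polys_below_def)
  have "coeff g m = 1" using h by (simp add: g)
  moreover have "degree g = m"
    using h \<open>coeff g m = 1\<close> by (intro antisym degree_le le_degree) (auto simp: g)
  ultimately show "g \<in> monics m" by (simp add: monics_def)
qed

lemma card_monics:
  "finite (monics m :: 'a::{field,finite} poly set)"
  "card (monics m :: 'a poly set) = CARD('a) ^ m"
proof -
  have "inj_on (\<lambda>h. monom 1 m + h) (polys_below m :: 'a poly set)" by (auto simp: inj_on_def)
  then show "finite (monics m :: 'a poly set)" "card (monics m :: 'a poly set) = CARD('a) ^ m"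
    by (simp_all add: monics_eq card_image card_polys_below)
qed

lemma monics_dvd_eq:
  fixes p :: "'a::field poly"
  assumes p: "p \<in> monics n" and "n \<le> m"
  shows "{g \<in> monics m. p dvd g} = (*) p ` monics (m - n)"
proof (intro equalityI subsetI)
  fix g assume "g \<in> {g \<in> monics m. p dvd g}"
  then obtain h where g: "g \<in> monics m" "g = p * h" by auto
  then have "p \<noteq> 0" "h \<noteq> 0" by (auto simp: monics_def)
  then have "h \<in> monics (m - n)" using g p by (auto simp: monics_def degree_mult_eq coeff_mult_degree_sum)
  then show "g \<in> (*) p ` monics (m - n)" using g by auto
next
  fix g assume "g \<in> (*) p ` monics (m - n)"
  then obtain h where h: "h \<in> monics (m - n)" "g = p * h" by auto
  then have "p \<noteq> 0" "h \<noteq> 0" using p by (auto simp: monics_def)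
  then show "g \<in> {g \<in> monics m. p dvd g}"
    using h p \<open>n \<le> m\<close> coeff_mult_degree_sum[of p h] by (auto simp: monics_def degree_mult_eq)
qed

lemma exists_monic_irreducible_factor:
  fixes g :: "'a::field poly"
  assumes "degree g > 0"
  shows "\<exists>\<pi>. irreducible \<pi> \<and> lead_coeff \<pi> = 1 \<and> \<pi> dvd g"
  using assms
proof (induction "degree g" arbitrary: g rule: less_induct)
  case less
  then have g0: "g \<noteq> 0" by auto
  show ?case
  proof (cases "irreducible g")
    case True
    let ?c = "inverse (lead_coeff g)"
    have c: "?c \<noteq> 0" using g0 by simp
    have "irreducible (smult ?c g)"
    proof (rule irreducibleI)
      show "smult ?c g \<noteq> 0" using c g0 by simp
      show "\<not> is_unit (smult ?c g)" using c g0 less.prems by (simp add: is_unit_iff_degree)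
      fix a b assume ab: "smult ?c g = a * b"
      then have "g = smult (lead_coeff g) a * b"
        using c by (metis inverse_inverse_eq mult_smult_left right_inverse smult_1_left smult_smult nonzero_imp_inverse_nonzero)
      then have "is_unit (smult (lead_coeff g) a) \<or> is_unit b" by (rule irreducibleD[OF True])
      moreover have "a \<noteq> 0" using ab c g0 by auto
      ultimately show "is_unit a \<or> is_unit b" using g0 by (auto simp: is_unit_iff_degree)
    qed
    moreover have "lead_coeff (smult ?c g) = 1" using g0 by simp
    moreover have "smult ?c g dvd g" using c by (simp add: smult_dvd_iff)
    ultimately show ?thesis by blast
  next
    case False
    then obtain a b where ab: "g = a * b" "\<not> is_unit a" "\<not> is_unit b"
      using less.prems g0 by (auto simp: irreducible_def is_unit_iff_degree)
    then have nz: "a \<noteq> 0" "b \<noteq> 0" using g0 by auto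
    then have "degree a > 0" "degree a < degree g"
      using ab by (auto simp: is_unit_iff_degree degree_mult_eq)
    from less.hyps[OF this(2) this(1)] show ?thesis using ab by (meson dvd_mult2)
  qed
qed

definition prime_power_factors :: "'a::field poly \<Rightarrow> ('a poly \<times> nat) set" where
  "prime_power_factors g = {(\<pi>, r). irreducible \<pi> \<and> lead_coeff \<pi> = 1 \<and> r \<ge> 1 \<and> \<pi> ^ r dvd g}"

lemma monic_irreducible_dvd_eq:
  fixes \<pi> \<rho> :: "'a::field poly"
  assumes "irreducible \<pi>" "irreducible \<rho>" "lead_coeff \<pi> = 1" "lead_coeff \<rho> = 1" "\<pi> dvd \<rho>"
  shows "\<pi> = \<rho>"
proof -
  from assms(5) obtain t where t: "\<rho> = \<pi> * t" by (elim dvdE)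
  then have "is_unit t" using assms(1,2) by (auto simp: irreducible_def)
  then obtain u where u: "t = [:u:]" by (auto elim: is_unit_polyE)
  have "lead_coeff \<pi> * lead_coeff t = 1" using assms(4) unfolding t lead_coeff_mult .
  then have "u = 1" unfolding assms(3) u by simp
  then show ?thesis using t u by simp
qed

text \<open>
  The additive form of unique factorization, the analogue of \<open>\<Sum>d dvd n. \<Lambda>(d) = ln n\<close> for the von
  Mangoldt function. Multiplying \<open>h\<close> by an irreducible \<open>\<pi>\<close> adds exactly one new prime power factor,
  namely \<open>\<pi> ^ Suc v\<close> where \<open>v\<close> is the multiplicity of \<open>\<pi>\<close> in \<open>h\<close>.
\<close>

lemma sum_prime_power_factors:
  fixes g :: "'a::field poly"
  assumes "g \<noteq> 0"
  shows "finite (prime_power_factors g) \<and> (\<Sum>(\<pi>, r)\<in>prime_power_factors g. degree \<pi>) = degree g"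
  using assms
proof (induction "degree g" arbitrary: g rule: less_induct)
  case (less g)
  show ?case
  proof (cases "degree g = 0")
    case True
    have "prime_power_factors g = {}"
    proof (rule ccontr)
      assume "prime_power_factors g \<noteq> {}"
      then obtain \<pi> r where *: "irreducible \<pi>" "r \<ge> 1" "\<pi> ^ r dvd g" by (auto simp: prime_power_factors_def)
      then have "\<pi> dvd g" by (meson dvd_power dvd_trans less_le_trans zero_less_one)
      then show False using dvd_imp_degree_le[of \<pi> g] True less.prems irreducible_poly_degree_pos[OF *(1)] by simp
    qed
    with True show ?thesis by simp
  next
    case False
    then obtain \<pi> where \<pi>: "irreducible \<pi>" "lead_coeff \<pi> = 1" "\<pi> dvd g"
      using exists_monic_irreducible_factor[of g] by auto
    then obtain h where g: "g = \<pi> * h" by auto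
    have prime: "prime_elem \<pi>" using \<pi>(1) by (rule field_poly_irreducible_imp_prime)
    have nz: "\<pi> \<noteq> 0" "h \<noteq> 0" using less.prems g by auto
    have dpos: "degree \<pi> > 0" by (rule irreducible_poly_degree_pos) fact
    have dg: "degree g = degree \<pi> + degree h" using nz by (simp add: g degree_mult_eq)
    have IH: "finite (prime_power_factors h)" "(\<Sum>(\<pi>, r)\<in>prime_power_factors h. degree \<pi>) = degree h"
      using less.hyps[of h] nz dg dpos by auto
    define v where "v = Max {r. \<pi> ^ r dvd h}"
    have fin: "finite {r. \<pi> ^ r dvd h}"
    proof (rule finite_subset)
      show "{r. \<pi> ^ r dvd h} \<subseteq> {..degree h}"
      proof
        fix r assume "r \<in> {r. \<pi> ^ r dvd h}"
        then have "degree (\<pi> ^ r) \<le> degree h" using nz by (auto intro: dvd_imp_degree_le)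
        then have "r * degree \<pi> \<le> degree h" using nz by (simp add: degree_power_eq)
        moreover have "r \<le> r * degree \<pi>" using dpos by (cases "degree \<pi>") auto
        ultimately show "r \<in> {..degree h}" by (metis atMost_iff le_trans)
      qed
    qed simp
    have "v \<in> {r. \<pi> ^ r dvd h}" unfolding v_def using fin by (intro Max_in) (auto intro: exI[of _ 0])
    then have v: "\<pi> ^ r dvd h \<longleftrightarrow> r \<le> v" for r
      using fin Max_ge[OF fin, of r] dvd_trans[OF le_imp_power_dvd[of r v \<pi>], of h] unfolding v_def by blast
    have other: "\<rho> ^ r dvd \<pi> * h \<longleftrightarrow> \<rho> ^ r dvd h" if "irreducible \<rho>" "lead_coeff \<rho> = 1" "\<rho> \<noteq> \<pi>" for \<rho> r
    proof
      have prime': "prime_elem \<rho>" using that(1) by (rule field_poly_irreducible_imp_prime)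
      have "\<not> \<pi> dvd \<rho>" using monic_irreducible_dvd_eq[of \<pi> \<rho>] that \<pi> by auto
      then have nd: "\<not> \<pi> dvd \<rho> ^ r" using prime by (auto dest: prime_elem_dvd_power)
      assume "\<rho> ^ r dvd \<pi> * h"
      then obtain s where s: "\<pi> * h = \<rho> ^ r * s" by (elim dvdE)
      then have "\<pi> dvd \<rho> ^ r * s" by (metis dvd_triv_left)
      then have "\<pi> dvd s" using nd prime by (simp add: prime_elem_dvd_mult_iff)
      then obtain s' where "s = \<pi> * s'" by (elim dvdE)
      then have "h = \<rho> ^ r * s'" using s nz by (simp add: mult.left_commute)
      then show "\<rho> ^ r dvd h" by simp
    qed simp
    have same: "\<pi> ^ r dvd \<pi> * h \<longleftrightarrow> r \<le> Suc v" for r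
      using nz v by (cases r) auto
    have eq: "prime_power_factors g = insert (\<pi>, Suc v) (prime_power_factors h)"
    proof (intro set_eqI)
      fix x :: "'a poly \<times> nat"
      obtain \<rho> r where x: "x = (\<rho>, r)" by (cases x)
      show "x \<in> prime_power_factors g \<longleftrightarrow> x \<in> insert (\<pi>, Suc v) (prime_power_factors h)"
        using \<pi> other[of \<rho> r] same[of r] v[of r]
        by (cases "\<rho> = \<pi>") (auto simp: x g prime_power_factors_def)
    qed
    have "(\<pi>, Suc v) \<notin> prime_power_factors h" using v[of "Suc v"] by (simp add: prime_power_factors_def)
    then show ?thesis using IH by (simp add: eq dg)
  qed
qed

definition prime_powers_of_degree :: "nat \<Rightarrow> ('a::field poly \<times> nat) set" where
  "prime_powers_of_degree n = {(\<pi>, r). irreducible \<pi> \<and> lead_coeff \<pi> = 1 \<and> r \<ge> 1 \<and> degree \<pi> * r = n}"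

lemma finite_prime_powers_of_degree: "finite (prime_powers_of_degree n :: ('a::{field,finite} poly \<times> nat) set)"
proof (rule finite_subset)
  show "prime_powers_of_degree n \<subseteq> (polys_below (Suc n) :: 'a poly set) \<times> {..n}"
  proof
    fix x :: "'a poly \<times> nat" assume "x \<in> prime_powers_of_degree n"
    then obtain \<pi> r where x: "x = (\<pi>, r)" "irreducible \<pi>" "r \<ge> 1" "degree \<pi> * r = n"
      by (auto simp: prime_powers_of_degree_def)
    have "degree \<pi> * 1 \<le> degree \<pi> * r" "1 * r \<le> degree \<pi> * r"
      using x irreducible_poly_degree_pos[OF x(2)] by (auto intro!: mult_le_mono simp del: mult_1_left mult_1_right)
    then show "x \<in> polys_below (Suc n) \<times> {..n}" using x by (auto simp: polys_below_eq)
  qed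
qed (simp add: card_polys_below)

text \<open>
  The coefficients of the logarithmic derivative of \<open>\<Sum>m. (\<Sum>g\<in>monics m. \<psi> g) T^m\<close>. A polynomial \<open>\<pi> ^ r\<close>
  has weight \<open>degree \<pi>\<close>, as with the von Mangoldt function.
\<close>

definition prime_power_sum :: "('a::field poly \<Rightarrow> int) \<Rightarrow> nat \<Rightarrow> int" where
  "prime_power_sum \<psi> n = (\<Sum>(\<pi>, r)\<in>prime_powers_of_degree n. int (degree \<pi>) * \<psi> \<pi> ^ r)"

text \<open>
  Write the factor \<open>m = degree g\<close> as the sum of the degrees of the prime power factors of \<open>g\<close> and sum
  over the prime powers first: the monic multiples of a prime power of degree \<open>n\<close> are its products with
  the monic polynomials of degree \<open>m - n\<close>, and \<open>\<psi>\<close> is multiplicative.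
\<close>

lemma newton_identity:
  fixes \<psi> :: "'a::{field,finite} poly \<Rightarrow> int"
  assumes one: "\<psi> 1 = 1"
    and mult: "\<And>g h. lead_coeff g = 1 \<Longrightarrow> lead_coeff h = 1 \<Longrightarrow> \<psi> (g * h) = \<psi> g * \<psi> h"
  shows "int m * (\<Sum>g\<in>monics m. \<psi> g)
       = (\<Sum>n\<in>{1..m}. prime_power_sum \<psi> n * (\<Sum>g\<in>monics (m - n). \<psi> g))"
proof -
  have power: "\<psi> (\<pi> ^ r) = \<psi> \<pi> ^ r" if "lead_coeff \<pi> = 1" for \<pi> r
    using that by (induction r) (simp_all add: one mult lead_coeff_power)
  define E where "E = (\<Union>n\<in>{1..m}. prime_powers_of_degree n :: ('a poly \<times> nat) set)"
  have finE: "finite E" by (simp add: E_def finite_prime_powers_of_degree)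
  have factors: "prime_power_factors g = {x \<in> E. fst x ^ snd x dvd g}" if g: "g \<in> monics m" for g
  proof (intro set_eqI)
    fix x :: "'a poly \<times> nat"
    obtain \<pi> r where x: "x = (\<pi>, r)" by (cases x)
    have g0: "g \<noteq> 0" using g by (auto simp: monics_def)
    have "1 \<le> degree \<pi> * r \<and> degree \<pi> * r \<le> m" if *: "irreducible \<pi>" "r \<ge> 1" "\<pi> ^ r dvd g"
    proof
      have "degree (\<pi> ^ r) \<le> degree g" using *(3) g0 by (rule dvd_imp_degree_le)
      moreover have "\<pi> \<noteq> 0" using *(1) by auto
      ultimately show "degree \<pi> * r \<le> m" using g by (simp add: degree_power_eq monics_def mult.commute)
      show "1 \<le> degree \<pi> * r" using irreducible_poly_degree_pos[OF *(1)] *(2) by (simp add: Suc_le_eq)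
    qed
    then show "x \<in> prime_power_factors g \<longleftrightarrow> x \<in> {x \<in> E. fst x ^ snd x dvd g}"
      by (auto simp: prime_power_factors_def E_def prime_powers_of_degree_def x)
  qed
  have "int m * (\<Sum>g\<in>monics m. \<psi> g) = (\<Sum>g\<in>monics m. int (degree g) * \<psi> g)"
    by (simp add: sum_distrib_left monics_def)
  also have "\<dots> = (\<Sum>g\<in>monics m. \<Sum>x\<in>{x \<in> E. fst x ^ snd x dvd g}. int (degree (fst x)) * \<psi> g)"
  proof (intro sum.cong refl)
    fix g :: "'a poly" assume g: "g \<in> monics m"
    then have "g \<noteq> 0" by (auto simp: monics_def)
    then have "degree g = (\<Sum>x\<in>prime_power_factors g. degree (fst x))"
      using sum_prime_power_factors[of g] by (simp add: case_prod_unfold)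
    then show "int (degree g) * \<psi> g = (\<Sum>x\<in>{x \<in> E. fst x ^ snd x dvd g}. int (degree (fst x)) * \<psi> g)"
      by (simp add: factors[OF g] flip: sum_distrib_right)
  qed
  also have "\<dots> = (\<Sum>x\<in>E. \<Sum>g\<in>{g \<in> monics m. fst x ^ snd x dvd g}. int (degree (fst x)) * \<psi> g)"
    by (rule sum.swap_restrict) (simp_all add: card_monics finE)
  also have "\<dots> = (\<Sum>n\<in>{1..m}. \<Sum>x\<in>prime_powers_of_degree n.
      \<Sum>g\<in>{g \<in> monics m. fst x ^ snd x dvd g}. int (degree (fst x)) * \<psi> g)"
    unfolding E_def
    by (rule sum.UNION_disjoint)
       (simp_all add: finite_prime_powers_of_degree, auto simp: prime_powers_of_degree_def)
  also have "\<dots> = (\<Sum>n\<in>{1..m}. prime_power_sum \<psi> n * (\<Sum>g\<in>monics (m - n). \<psi> g))"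
  proof (intro sum.cong refl)
    fix n assume n: "n \<in> {1..m}"
    have "(\<Sum>g\<in>{g \<in> monics m. fst x ^ snd x dvd g}. int (degree (fst x)) * \<psi> g)
        = int (degree (fst x)) * \<psi> (fst x) ^ snd x * (\<Sum>g\<in>monics (m - n). \<psi> g)"
      if x: "x \<in> prime_powers_of_degree n" for x
    proof -
      define p where "p = fst x ^ snd x"
      have lc: "lead_coeff (fst x) = 1" and deg: "degree (fst x) * snd x = n"
        using x by (auto simp: prime_powers_of_degree_def)
      then have "fst x \<noteq> 0" by auto
      then have "degree p = n" using deg by (simp add: p_def degree_power_eq mult.commute)
      moreover have "lead_coeff p = 1" by (simp only: p_def lead_coeff_power lc power_one)
      ultimately have p: "p \<in> monics n" by (simp add: monics_def)
      then have "p \<noteq> 0" by (auto simp: monics_def)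
      then have inj: "inj_on ((*) p) (monics (m - n))" by (auto simp: inj_on_def)
      have "(\<Sum>g\<in>{g \<in> monics m. p dvd g}. int (degree (fst x)) * \<psi> g)
          = int (degree (fst x)) * (\<Sum>g\<in>{g \<in> monics m. p dvd g}. \<psi> g)"
        by (rule sum_distrib_left[symmetric])
      also have "(\<Sum>g\<in>{g \<in> monics m. p dvd g}. \<psi> g) = (\<Sum>h\<in>monics (m - n). \<psi> (p * h))"
        using p n inj by (simp add: monics_dvd_eq[of p n] sum.reindex)
      also have "\<dots> = (\<Sum>h\<in>monics (m - n). \<psi> p * \<psi> h)"
        using p by (intro sum.cong refl mult) (auto simp: monics_def)
      also have "\<dots> = \<psi> p * (\<Sum>h\<in>monics (m - n). \<psi> h)"
        by (rule sum_distrib_left[symmetric])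
      also have "\<psi> p = \<psi> (fst x) ^ snd x"
        unfolding p_def by (rule power[OF lc])
      finally show ?thesis by (simp only: p_def mult.assoc)
    qed
    then show "(\<Sum>x\<in>prime_powers_of_degree n.
        \<Sum>g\<in>{g \<in> monics m. fst x ^ snd x dvd g}. int (degree (fst x)) * \<psi> g)
      = prime_power_sum \<psi> n * (\<Sum>g\<in>monics (m - n). \<psi> g)"
      by (simp add: prime_power_sum_def case_prod_unfold sum_distrib_right)
  qed
  finally show ?thesis .
qed

text \<open>
  The Newton identities of the constant function \<open>1\<close>, whose sums are \<open>q ^ m\<close>. Equivalently, the degrees
  of the irreducible factors of \<open>X^(q^n) - X\<close> add up to \<open>q ^ n\<close>.
\<close>

lemma sum_degrees_prime_powers:
  assumes "n \<ge> 1"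
  shows "(\<Sum>(\<pi>, r)\<in>prime_powers_of_degree n. int (degree (\<pi> :: 'a::{field,finite} poly))) = int CARD('a) ^ n"
proof -
  let ?\<psi> = "\<lambda>_ :: 'a poly. 1 :: int"
  have "prime_power_sum ?\<psi> n = int CARD('a) ^ n"
    using assms
  proof (induction n rule: less_induct)
    case (less n)
    have split: "{1..n} = insert n {1..<n}" using less.prems by auto
    have "int n * int CARD('a) ^ n
      = (\<Sum>k\<in>{1..n}. prime_power_sum ?\<psi> k * int CARD('a) ^ (n - k))"
      using newton_identity[of ?\<psi> n] by (simp add: card_monics)
    also have "\<dots> = prime_power_sum ?\<psi> n + (\<Sum>k\<in>{1..<n}. prime_power_sum ?\<psi> k * int CARD('a) ^ (n - k))"
      unfolding split by simp
    also have "(\<Sum>k\<in>{1..<n}. prime_power_sum ?\<psi> k * int CARD('a) ^ (n - k)) = (\<Sum>k\<in>{1..<n}. int CARD('a) ^ n)"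
      using less.IH by (intro sum.cong refl) (simp flip: power_add)
    finally show ?case using less.prems by (simp add: algebra_simps of_nat_diff)
  qed
  then show ?thesis by (simp add: prime_power_sum_def)
qed

lemma poly_char_mult:
  fixes g h :: "'a::{field,finite} poly"
  assumes "odd CARD('a)" "lead_coeff g = 1" "lead_coeff h = 1"
  shows "poly_char A (g * h) = poly_char A g * poly_char A h"
proof -
  have "g \<noteq> 0" "h \<noteq> 0" using assms by auto
  then have eq: "(-1) ^ degree (g * h) * poly (g * h) a
      = ((-1) ^ degree g * poly g a) * ((-1) ^ degree h * poly h a)" for a
    by (simp add: degree_mult_eq power_add mult_ac)
  have "quad_char ((-1) ^ degree (g * h) * poly (g * h) a)
      = quad_char ((-1) ^ degree g * poly g a) * quad_char ((-1) ^ degree h * poly h a)" for a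
    unfolding eq by (rule quad_char_mult[OF assms(1)])
  then show ?thesis by (simp only: poly_char_def prod.distrib)
qed

lemma poly_char_1: "poly_char A 1 = 1"
  by (simp add: poly_char_def)

lemma sum_poly_char_0: "(\<Sum>g\<in>monics 0. poly_char A g) = 1"
proof -
  have "monics 0 = {1 :: 'a poly}"
    by (auto simp: monics_def elim!: degree_eq_zeroE)
  then show ?thesis by (simp add: poly_char_1)
qed

lemma sum_poly_char_1:
  "(\<Sum>g\<in>monics 1. poly_char A g) = (\<Sum>v\<in>UNIV. \<Prod>a\<in>A. quad_char (v - a))"
proof -
  have "bij_betw (\<lambda>v. [:-v, 1:]) UNIV (monics 1 :: 'a poly set)"
  proof (rule bij_betwI')
    fix g :: "'a poly" assume "g \<in> monics 1"
    then have g: "degree g = 1" "coeff g 1 = 1" by (auto simp: monics_def)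
    then have "g = [:- (- coeff g 0), 1:]"
      by (intro poly_eqI) (auto simp: coeff_pCons coeff_eq_0 split: nat.splits)
    then show "\<exists>v\<in>UNIV. g = [:-v, 1:]" by blast
  qed (auto simp: monics_def)
  from sum.reindex_bij_betw[OF this, of "poly_char A"] show ?thesis
    by (simp add: poly_char_def)
qed

text \<open>
  Since \<open>m \<ge> card A\<close>, the value of \<open>g\<close> at one point \<open>b\<close> of \<open>A\<close> can be multiplied by a nonresidue without
  affecting the other points of \<open>A\<close>, by adding a multiple of a polynomial of degree \<open>card A - 1\<close> that
  vanishes there. This is a bijection on the monic polynomials of degree \<open>m\<close>, and it flips the sign of
  \<open>poly_char A g\<close>.
\<close>

lemma sum_poly_char_eq_0:
  fixes A :: "'a::{field,finite} set"
  assumes odd: "odd CARD('a)" and "A \<noteq> {}" and m: "m \<ge> card A"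
  shows "(\<Sum>g\<in>monics m. poly_char A g) = 0"
proof -
  obtain b where b: "b \<in> A" using \<open>A \<noteq> {}\<close> by auto
  obtain c :: 'a where c: "quad_char c = -1" using quad_char_nonresidue[OF odd] by blast
  then have c0: "c \<noteq> 0" by auto
  define L where "L = (\<Prod>a\<in>A - {b}. [:-a, 1:])"
  define u where "u = poly L b"
  have u: "u \<noteq> 0" by (simp add: u_def L_def poly_prod)
  have L0: "poly L a = 0" if "a \<in> A" "a \<noteq> b" for a
    using that by (auto simp: L_def poly_prod)
  have "degree L = card (A - {b})"
    unfolding L_def by (subst degree_prod_eq_sum_degree) auto
  moreover have "card (A - {b}) < card A" using b by (intro card_Diff1_less) auto
  ultimately have degL: "degree L < m" using m by simp
  define T where "T d g = g + smult ((d - 1) * poly g b / u) L" for d and g :: "'a poly"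
  have Tb: "poly (T d g) b = d * poly g b" for d g
  proof -
    have "(d - 1) * poly g b / u * u = (d - 1) * poly g b" using u by simp
    then show ?thesis unfolding T_def poly_add poly_smult u_def[symmetric] by (simp only: left_diff_distrib) simp
  qed
  have Ta: "poly (T d g) a = poly g a" if "a \<in> A" "a \<noteq> b" for d g a
    using L0[OF that] by (simp add: T_def)
  have Tm: "T d g \<in> monics m" if "g \<in> monics m" for d g
  proof -
    have g: "degree g = m" "coeff g m = 1" using that by (auto simp: monics_def)
    have small: "degree (smult x L) < degree g" for x
      using degL degree_smult_le[of x L] g by linarith
    have "degree (T d g) = m" unfolding T_def using degree_add_eq_left[OF small] g by simp
    moreover have "coeff (T d g) m = 1" using degL g by (simp add: T_def coeff_eq_0)
    ultimately show ?thesis by (simp add: monics_def)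
  qed
  have TT: "T d (T d' g) = g" if "d * d' = 1" for d d' g
  proof -
    have "(d' - 1) * poly g b / u + (d - 1) * (d' * poly g b) / u = (d * d' - 1) * poly g b / u"
      using u by (simp add: field_simps)
    then have "smult ((d' - 1) * poly g b / u) L + smult ((d - 1) * (d' * poly g b) / u) L = 0"
      using that by (simp flip: smult_add_left)
    then show ?thesis unfolding T_def[of d] Tb by (simp add: T_def add.assoc)
  qed
  have bij: "bij_betw (T c) (monics m) (monics m)"
    by (rule bij_betw_byWitness[where f' = "T (inverse c)"]) (use c0 Tm TT in auto)
  have flip: "poly_char A (T c g) = - poly_char A g" if g: "g \<in> monics m" for g
  proof -
    have deg: "degree (T c g) = degree g" using Tm[OF g, of c] g by (simp add: monics_def)
    have "poly_char A (T c g) = quad_char ((-1) ^ degree g * (c * poly g b)) *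
        (\<Prod>a\<in>A - {b}. quad_char ((-1) ^ degree g * poly g a))"
      unfolding poly_char_def deg using b Ta by (subst prod.remove[of A b]) (auto simp: Tb)
    also have "(-1) ^ degree g * (c * poly g b) = c * ((-1) ^ degree g * poly g b)" by (simp add: mult_ac)
    also have "quad_char \<dots> = - quad_char ((-1) ^ degree g * poly g b)"
      by (simp only: quad_char_mult[OF odd, of c] c)
    finally show ?thesis unfolding poly_char_def using b by (subst (2) prod.remove[of A b]) auto
  qed
  have "(\<Sum>g\<in>monics m. poly_char A g) = (\<Sum>g\<in>monics m. poly_char A (T c g))"
    using sum.reindex_bij_betw[OF bij, of "poly_char A"] by simp
  also have "\<dots> = - (\<Sum>g\<in>monics m. poly_char A g)" using flip by (simp add: sum_negf)
  finally show ?thesis by simp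
qed

section \<open>Taylor expansions modulo a power\<close>

text \<open>
  Later \<open>Z\<close> is \<open>X^Q\<close>, \<open>W\<close> is \<open>X - Z\<close>, and \<open>R\<close> is a product of powers \<open>\<pi> ^ l\<close>. Modulo \<open>\<pi> ^ l\<close> the
  polynomial \<open>Z\<close> is a root of \<open>\<pi>\<close>, and \<open>W\<close> is a local parameter with \<open>W ^ l = 0\<close>. So the sum is a
  truncated Taylor expansion, with coefficients that are polynomials of degree at most \<open>n\<close> in the root.
  Only the existence of coefficients is recorded, since in the end their number is all that counts: it
  replaces the derivatives of the usual form of Stepanov's method.
\<close>

definition taylor_bounded :: "'a::field poly \<Rightarrow> 'a poly \<Rightarrow> 'a poly \<Rightarrow> nat \<Rightarrow> nat \<Rightarrow> 'a poly set" where
  "taylor_bounded R Z W l n =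
     {h. \<exists>e. (\<forall>i<l. e i \<in> polys_below (Suc n)) \<and> [h = (\<Sum>i<l. W ^ i * pcompose (e i) Z)] (mod R)}"

lemma polys_below_Suc_iff: "h \<in> polys_below (Suc n) \<longleftrightarrow> degree h \<le> n"
  by (auto simp: polys_below_eq)

context
  fixes R Z W :: "'a::field poly" and l :: nat
  assumes R: "R dvd W ^ l"
begin

lemma taylor_bounded_cong:
  "[h = h'] (mod R) \<Longrightarrow> h' \<in> taylor_bounded R Z W l n \<Longrightarrow> h \<in> taylor_bounded R Z W l n"
  unfolding taylor_bounded_def using cong_trans by blast

lemma taylor_bounded_add:
  assumes "g \<in> taylor_bounded R Z W l n" "h \<in> taylor_bounded R Z W l n"
  shows "g + h \<in> taylor_bounded R Z W l n"
proof -
  from assms obtain d e where *: "\<And>i. i < l \<Longrightarrow> degree (d i) \<le> n" "\<And>i. i < l \<Longrightarrow> degree (e i) \<le> n"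
      "[g = (\<Sum>i<l. W ^ i * pcompose (d i) Z)] (mod R)" "[h = (\<Sum>i<l. W ^ i * pcompose (e i) Z)] (mod R)"
    by (auto simp: taylor_bounded_def polys_below_Suc_iff)
  have "[g + h = (\<Sum>i<l. W ^ i * pcompose (d i + e i) Z)] (mod R)"
    using cong_add[OF *(3,4)] by (simp add: pcompose_add distrib_left sum.distrib)
  then show ?thesis using *(1,2)
    by (auto simp: taylor_bounded_def polys_below_Suc_iff intro!: exI[of _ "\<lambda>i. d i + e i"] degree_add_le)
qed

lemma taylor_bounded_0: "0 \<in> taylor_bounded R Z W l n"
  by (auto simp: taylor_bounded_def polys_below_Suc_iff intro!: exI[of _ "\<lambda>_. 0"])

lemma taylor_bounded_sum:
  "(\<And>x. x \<in> S \<Longrightarrow> g x \<in> taylor_bounded R Z W l n) \<Longrightarrow> (\<Sum>x\<in>S. g x) \<in> taylor_bounded R Z W l n"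
  by (induction S rule: infinite_finite_induct) (auto intro: taylor_bounded_add taylor_bounded_0)

lemma taylor_bounded_pcompose_mult:
  assumes "g \<in> taylor_bounded R Z W l n" "degree c \<le> n'"
  shows "pcompose c Z * g \<in> taylor_bounded R Z W l (n' + n)"
proof -
  from assms obtain d where *: "\<And>i. i < l \<Longrightarrow> degree (d i) \<le> n"
      "[g = (\<Sum>i<l. W ^ i * pcompose (d i) Z)] (mod R)"
    by (auto simp: taylor_bounded_def polys_below_Suc_iff)
  have "[pcompose c Z * g = (\<Sum>i<l. W ^ i * pcompose (c * d i) Z)] (mod R)"
    using cong_mult[OF cong_refl *(2), of "pcompose c Z"]
    by (simp add: pcompose_mult sum_distrib_left mult_ac)
  moreover have "degree (c * d i) \<le> n' + n" if "i < l" for i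
    using *(1)[OF that] assms(2) degree_mult_le[of c "d i"] by linarith
  ultimately show ?thesis
    by (auto simp: taylor_bounded_def polys_below_Suc_iff intro!: exI[of _ "\<lambda>i. c * d i"])
qed

lemma taylor_bounded_W_mult:
  assumes "g \<in> taylor_bounded R Z W l n"
  shows "W * g \<in> taylor_bounded R Z W l n"
proof -
  from assms obtain d where *: "\<And>i. i < l \<Longrightarrow> degree (d i) \<le> n"
      "[g = (\<Sum>i<l. W ^ i * pcompose (d i) Z)] (mod R)"
    by (auto simp: taylor_bounded_def polys_below_Suc_iff)
  define e where "e = (\<lambda>i. if i = 0 then 0 else d (i - 1))"
  have "[W * g = W * (\<Sum>i<l. W ^ i * pcompose (d i) Z)] (mod R)"
    by (intro cong_mult cong_refl *)
  also have "W * (\<Sum>i<l. W ^ i * pcompose (d i) Z) = (\<Sum>i<Suc l. W ^ i * pcompose (e i) Z)"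
    unfolding sum.lessThan_Suc_shift by (simp add: e_def sum_distrib_left mult_ac)
  also have "\<dots> = (\<Sum>i<l. W ^ i * pcompose (e i) Z) + W ^ l * pcompose (e l) Z" by simp
  also have "[\<dots> = (\<Sum>i<l. W ^ i * pcompose (e i) Z)] (mod R)"
    using R by (simp add: cong_iff_dvd_diff)
  finally show ?thesis using *(1)
    by (auto simp: taylor_bounded_def polys_below_Suc_iff e_def intro!: exI[of _ e])
qed

lemma taylor_bounded_mult:
  assumes "g \<in> taylor_bounded R Z W l n" "h \<in> taylor_bounded R Z W l n'"
  shows "g * h \<in> taylor_bounded R Z W l (n + n')"
proof -
  from assms(1) obtain d where *: "\<And>i. i < l \<Longrightarrow> degree (d i) \<le> n"
      "[g = (\<Sum>i<l. W ^ i * pcompose (d i) Z)] (mod R)"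
    by (auto simp: taylor_bounded_def polys_below_Suc_iff)
  have W: "W ^ i * x \<in> taylor_bounded R Z W l (n + n')" if "x \<in> taylor_bounded R Z W l (n + n')" for i x
    using that by (induction i) (auto simp: mult.assoc intro: taylor_bounded_W_mult)
  have "[g * h = (\<Sum>i<l. W ^ i * (pcompose (d i) Z * h))] (mod R)"
    using cong_mult[OF *(2) cong_refl, of h] by (simp add: sum_distrib_right mult.assoc)
  moreover have "(\<Sum>i<l. W ^ i * (pcompose (d i) Z * h)) \<in> taylor_bounded R Z W l (n + n')"
    using * assms(2) by (intro taylor_bounded_sum W taylor_bounded_pcompose_mult) auto
  ultimately show ?thesis by (rule taylor_bounded_cong)
qed

lemma taylor_bounded_mono:
  "g \<in> taylor_bounded R Z W l n \<Longrightarrow> n \<le> n' \<Longrightarrow> g \<in> taylor_bounded R Z W l n'"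
  using taylor_bounded_pcompose_mult[of g n 1 "n' - n"] by (simp add: pcompose_1)

lemma taylor_bounded_1:
  "1 \<in> taylor_bounded R Z W l 0"
proof (cases l)
  case 0
  with R show ?thesis by (auto simp: taylor_bounded_def intro!: exI[of _ "\<lambda>_. 0"] simp: cong_iff_dvd_diff)
next
  case (Suc l')
  have "(\<Sum>i<l. W ^ i * pcompose (if i = 0 then 1 else 0) Z) = 1"
    unfolding Suc sum.lessThan_Suc_shift by (simp add: pcompose_1)
  then show ?thesis
    by (auto simp: taylor_bounded_def polys_below_Suc_iff intro!: exI[of _ "\<lambda>i. if i = 0 then 1 else 0"])
qed

lemma taylor_bounded_pcompose:
  "degree c \<le> n \<Longrightarrow> pcompose c Z \<in> taylor_bounded R Z W l n"
  using taylor_bounded_pcompose_mult[OF taylor_bounded_1, of c n] by simp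

lemma taylor_bounded_power:
  "g \<in> taylor_bounded R Z W l n \<Longrightarrow> g ^ i \<in> taylor_bounded R Z W l (i * n)"
  by (induction i) (auto intro: taylor_bounded_1 taylor_bounded_mult)

lemma taylor_bounded_smult:
  "g \<in> taylor_bounded R Z W l n \<Longrightarrow> smult c g \<in> taylor_bounded R Z W l n"
  using taylor_bounded_pcompose_mult[of g n "[:c:]" 0] by simp

lemma taylor_bounded_poly:
  assumes X: "[:0, 1:] = Z + W" and "degree h \<le> n"
  shows "h \<in> taylor_bounded R Z W l n"
proof -
  have Z: "Z \<in> taylor_bounded R Z W l 1"
    using taylor_bounded_pcompose[of "[:0, 1:]" 1] by (simp add: pcompose_pCons)
  have W: "W \<in> taylor_bounded R Z W l 1"
    using taylor_bounded_W_mult[OF taylor_bounded_1] by (auto intro: taylor_bounded_mono)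
  have "monom (coeff h i) i \<in> taylor_bounded R Z W l n" if "i \<le> degree h" for i
  proof -
    have "[:0, 1:] ^ i \<in> taylor_bounded R Z W l (i * 1)"
      unfolding X by (intro taylor_bounded_power taylor_bounded_add Z W)
    then have "[:0, 1:] ^ i \<in> taylor_bounded R Z W l n"
      using that assms(2) by (auto intro: taylor_bounded_mono)
    then show ?thesis unfolding monom_altdef by (rule taylor_bounded_smult)
  qed
  then have "(\<Sum>i\<le>degree h. monom (coeff h i) i) \<in> taylor_bounded R Z W l n"
    by (intro taylor_bounded_sum) auto
  then show ?thesis by (simp add: poly_as_sum_of_monoms)
qed

text \<open>
  The degree of \<open>f ^ m\<close> is large, yet its expansion is short: expand \<open>f = F + (f - F)\<close> with
  \<open>F = pcompose f Z\<close> by the binomial theorem. Powers of \<open>f - F\<close> from the \<open>l\<close>-th on vanish modulo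
  \<open>R\<close>. In the remaining terms the factor \<open>F ^ l\<close> makes up for the \<open>i\<close> missing factors of \<open>F ^ (m - i)\<close>,
  so that \<open>F ^ m\<close> splits off, which is the constant \<open>\<epsilon>\<close>.
\<close>

lemma taylor_bounded_power_residue:
  fixes f \<epsilon> :: "'a poly"
  assumes X: "[:0, 1:] = Z + W" and \<epsilon>: "\<epsilon> = [:c:]" "[pcompose f Z ^ m = \<epsilon>] (mod R)"
  shows "pcompose f Z ^ l * f ^ m \<in> taylor_bounded R Z W l (l * degree f)"
proof -
  let ?T = "taylor_bounded R Z W l" and ?F = "pcompose f Z"
  have F: "?F \<in> ?T (degree f)" by (rule taylor_bounded_pcompose) simp
  have G: "f - ?F \<in> ?T (degree f)"
  proof -
    have "f + smult (-1) ?F \<in> ?T (degree f)"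
      by (intro taylor_bounded_add taylor_bounded_smult F taylor_bounded_poly X order_refl)
    then show ?thesis by simp
  qed
  have "W dvd f - ?F"
  proof (induction f)
    case (pCons a f)
    have "pCons a f - pcompose (pCons a f) Z = [:0, 1:] * f - Z * pcompose f Z"
      by (simp add: pcompose_pCons)
    also have "\<dots> = (Z + W) * (f - pcompose f Z) + W * pcompose f Z"
      unfolding X by (simp add: algebra_simps)
    finally have "pCons a f - pcompose (pCons a f) Z = (Z + W) * (f - pcompose f Z) + W * pcompose f Z" .
    then show ?case using pCons by auto
  qed simp
  then have "W ^ l dvd (f - ?F) ^ i" if "l \<le> i" for i
    using that by (meson dvd_power_same dvd_trans le_imp_power_dvd)
  then have high: "R dvd (f - ?F) ^ i" if "l \<le> i" for i
    using that R dvd_trans by blast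
  have "f ^ m = (\<Sum>i\<le>m. of_nat (m choose i) * (f - ?F) ^ i * ?F ^ (m - i))"
    using binomial_ring[of "f - ?F" ?F m] by simp
  then have "?F ^ l * f ^ m = (\<Sum>i\<le>m. of_nat (m choose i) * (f - ?F) ^ i * ?F ^ (m - i) * ?F ^ l)"
    by (simp only: sum_distrib_right mult.commute[of "?F ^ l"])
  moreover have "of_nat (m choose i) * (f - ?F) ^ i * ?F ^ (m - i) * ?F ^ l \<in> ?T (l * degree f)"
    if i: "i \<le> m" for i
  proof (cases "i < l")
    case True
    have "?F ^ (m - i) * ?F ^ l = ?F ^ (l - i) * ?F ^ m"
      using i True by (simp add: add.commute flip: power_add)
    then have "of_nat (m choose i) * (f - ?F) ^ i * ?F ^ (m - i) * ?F ^ l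
        = (of_nat (m choose i) * (f - ?F) ^ i * ?F ^ (l - i)) * ?F ^ m"
      by (simp add: mult.assoc)
    also have "[\<dots> = (of_nat (m choose i) * (f - ?F) ^ i * ?F ^ (l - i)) * \<epsilon>] (mod R)"
      by (intro cong_mult cong_refl \<epsilon>)
    also have "(of_nat (m choose i) * (f - ?F) ^ i * ?F ^ (l - i)) * \<epsilon>
        = smult (c * of_nat (m choose i)) ((f - ?F) ^ i * ?F ^ (l - i))"
      by (simp add: \<epsilon>(1) of_nat_poly mult_ac)
    finally have "[of_nat (m choose i) * (f - ?F) ^ i * ?F ^ (m - i) * ?F ^ l
        = smult (c * of_nat (m choose i)) ((f - ?F) ^ i * ?F ^ (l - i))] (mod R)" .
    moreover have "(f - ?F) ^ i * ?F ^ (l - i) \<in> ?T (i * degree f + (l - i) * degree f)"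
      by (intro taylor_bounded_mult taylor_bounded_power F G)
    then have "(f - ?F) ^ i * ?F ^ (l - i) \<in> ?T (l * degree f)"
      using True by (simp flip: distrib_right)
    ultimately show ?thesis by (blast intro: taylor_bounded_cong taylor_bounded_smult)
  next
    case False
    then have "[of_nat (m choose i) * (f - ?F) ^ i * ?F ^ (m - i) * ?F ^ l = 0] (mod R)"
      using high[of i] by (simp add: cong_iff_dvd_diff)
    then show ?thesis by (rule taylor_bounded_cong) (rule taylor_bounded_0)
  qed
  ultimately show ?thesis by (simp only:) (intro taylor_bounded_sum, auto)
qed

end

section \<open>Stepanov's method\<close>

lemma prime_elem_power_dvd_cancel:
  fixes p :: "'b::idom"
  assumes "prime_elem p" "\<not> p dvd u" "p ^ l dvd u * h"
  shows "p ^ l dvd h"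
  using assms(3)
proof (induction l)
  case (Suc l)
  then have "p ^ l dvd h" by (meson dvd_trans le_SucI le_imp_power_dvd order_refl)
  then obtain s where s: "h = p ^ l * s" by (elim dvdE)
  from Suc.prems obtain t where "u * h = p ^ Suc l * t" by (elim dvdE)
  then have "p ^ l * (u * s) = p ^ l * (p * t)" by (simp add: s mult_ac)
  moreover have "p \<noteq> 0" using assms(1) by auto
  ultimately have "u * s = p * t" by simp
  then have "p dvd u * s" by simp
  then have "p dvd s" using assms(1,2) by (simp add: prime_elem_dvd_mult_iff)
  then show ?case by (auto simp: s intro: mult_dvd_mono)
qed simp

text \<open>
  Distinct monic irreducible polynomials are coprime.
\<close>

lemma prod_irreducible_power_dvd:
  fixes P :: "'a::field poly set"
  assumes "finite P" "\<And>\<pi>. \<pi> \<in> P \<Longrightarrow> irreducible \<pi>" "\<And>\<pi>. \<pi> \<in> P \<Longrightarrow> lead_coeff \<pi> = 1"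
    and "\<And>\<pi>. \<pi> \<in> P \<Longrightarrow> \<pi> ^ l dvd h"
  shows "(\<Prod>P) ^ l dvd h"
  using assms
proof (induction P arbitrary: h rule: finite_induct)
  case (insert \<pi> P)
  have prime: "prime_elem \<rho>" if "\<rho> \<in> insert \<pi> P" for \<rho>
    using insert.prems(1)[OF that] by (rule field_poly_irreducible_imp_prime)
  obtain s where s: "h = \<pi> ^ l * s" using insert.prems(3)[of \<pi>] by auto
  have "(\<Prod>P) ^ l dvd s"
  proof (rule insert.IH)
    fix \<rho> assume \<rho>: "\<rho> \<in> P"
    have "\<not> \<rho> dvd \<pi>"
      using monic_irreducible_dvd_eq[of \<rho> \<pi>] insert.prems(1,2) insert.hyps(2) \<rho> by auto
    then have "\<not> \<rho> dvd \<pi> ^ l" using prime[of \<rho>] \<rho> by (auto dest: prime_elem_dvd_power)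
    then show "\<rho> ^ l dvd s"
      using prime_elem_power_dvd_cancel[of \<rho> "\<pi> ^ l" l s] prime[of \<rho>] \<rho> insert.prems(3)[of \<rho>] s by auto
  qed (use insert.prems in auto)
  then have "\<pi> ^ l * (\<Prod>P) ^ l dvd h" unfolding s by (intro mult_dvd_mono dvd_refl)
  then show ?case using insert.hyps by (simp add: power_mult_distrib)
qed simp

text \<open>
  The first nonzero term determines the order at \<open>b\<close>: the coefficient contributes less than \<open>K\<close>, and
  the power of \<open>X - b\<close> a multiple of \<open>Q\<close>.
\<close>

lemma sum_scaled_powers_nonzero:
  fixes b :: "'a::field" and A :: "nat \<Rightarrow> 'a poly"
  assumes "K \<le> Q" "\<And>j. j < J \<Longrightarrow> A j \<in> polys_below K" "\<exists>j<J. A j \<noteq> 0"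
  shows "(\<Sum>j<J. A j * ([:-b, 1:] ^ Q) ^ j) \<noteq> 0
    \<and> order b (\<Sum>j<J. A j * ([:-b, 1:] ^ Q) ^ j) mod Q < K"
  using assms(2,3)
proof (induction J arbitrary: A)
  case (Suc J)
  define Y where "Y = [:-b, 1:] ^ Q"
  define T where "T = (\<Sum>j<J. A (Suc j) * Y ^ j)"
  have Y0: "Y \<noteq> 0" by (simp add: Y_def)
  have eq: "(\<Sum>j<Suc J. A j * Y ^ j) = A 0 + Y * T"
    unfolding T_def sum.lessThan_Suc_shift by (simp add: sum_distrib_left mult_ac)
  show ?case
  proof (cases "A 0 = 0")
    case True
    with Suc.prems(2) have "\<exists>j<J. A (Suc j) \<noteq> 0" by (metis less_Suc_eq_0_disj)
    then have "T \<noteq> 0 \<and> order b T mod Q < K"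
      unfolding T_def Y_def using Suc.prems(1) by (intro Suc.IH) auto
    moreover have "order b Y = Q" unfolding Y_def by (rule order_power_n_n)
    ultimately show ?thesis unfolding Y_def[symmetric] eq using Y0 by (simp add: True order_mult)
  next
    case False
    define o0 where "o0 = order b (A 0)"
    have "o0 \<le> degree (A 0)" unfolding o0_def using False by (rule order_degree)
    moreover have "degree (A 0) < K" using Suc.prems(1)[of 0] False by (auto simp: polys_below_eq)
    ultimately have o0: "o0 < K" by simp
    have "[:-b, 1:] ^ Suc o0 dvd Y"
      unfolding Y_def using o0 assms(1) by (intro le_imp_power_dvd) auto
    then have Y: "[:-b, 1:] ^ Suc o0 dvd Y * T" by simp
    have A: "\<not> [:-b, 1:] ^ Suc o0 dvd A 0" "[:-b, 1:] ^ o0 dvd A 0"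
      using False by (auto simp: o0_def order_2 order_1 simp del: power_Suc)
    have n: "\<not> [:-b, 1:] ^ Suc o0 dvd A 0 + Y * T" using A(1) dvd_add_left_iff[OF Y, of "A 0"] by blast
    have "[:-b, 1:] ^ o0 dvd A 0 + Y * T"
      using A(2) Y by (meson dvd_add dvd_trans le_imp_power_dvd le_SucI order_refl)
    then have "order b (A 0 + Y * T) = o0" using n by (rule order_unique_lemma)
    moreover have "A 0 + Y * T \<noteq> 0" using n by auto
    ultimately show ?thesis unfolding Y_def[symmetric] eq using o0 assms(1) by simp
  qed
qed simp

text \<open>
  If \<open>U + V f^m = 0\<close>, then \<open>U^2 f = V^2 f^Q\<close>. As \<open>b\<close> is a simple root of \<open>f\<close>, comparing the orders at \<open>b\<close>
  modulo \<open>Q\<close> equates an odd and an even number, both smaller than \<open>Q\<close>.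
\<close>

lemma stepanov_auxiliary_nonzero:
  fixes b :: "'a::field" and A B :: "nat \<Rightarrow> 'a poly"
  assumes Q: "Q = 2 * m + 1"
    and f0: "f \<noteq> 0" and f: "order b f = 1" "f ^ Q = pcompose f Z"
    and A: "\<And>j. j < J \<Longrightarrow> A j \<in> polys_below m" and B: "\<And>j. j < J \<Longrightarrow> B j \<in> polys_below m"
    and nz: "\<exists>j<J. A j \<noteq> 0 \<or> B j \<noteq> 0"
  shows "(\<Sum>j<J. (A j + B j * f ^ m) * ([:-b, 1:] ^ Q) ^ j) \<noteq> 0"
proof
  define U where "U = (\<Sum>j<J. A j * ([:-b, 1:] ^ Q) ^ j)"
  define V where "V = (\<Sum>j<J. B j * ([:-b, 1:] ^ Q) ^ j)"
  assume "(\<Sum>j<J. (A j + B j * f ^ m) * ([:-b, 1:] ^ Q) ^ j) = 0"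
  then have "U + V * f ^ m = 0"
    by (simp add: U_def V_def distrib_right sum.distrib sum_distrib_right sum_distrib_left mult_ac)
  then have "U = - (V * f ^ m)" by (simp add: eq_neg_iff_add_eq_0)
  moreover have "f ^ Q = f ^ m * f ^ m * f" by (simp add: Q power_add mult_2)
  ultimately have eq: "U * U * f = V * V * f ^ Q" by (simp add: mult_ac)
  then have UV: "U = 0 \<longleftrightarrow> V = 0" using f0 by auto
  moreover have "\<not> (U = 0 \<and> V = 0)"
    using nz sum_scaled_powers_nonzero[of m Q J A b] sum_scaled_powers_nonzero[of m Q J B b] A B
    unfolding U_def V_def Q by auto
  ultimately have "U \<noteq> 0" "V \<noteq> 0" by auto
  have "\<exists>j<J. A j \<noteq> 0"
  proof (rule ccontr)
    assume "\<not> (\<exists>j<J. A j \<noteq> 0)"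
    then have "U = 0" by (simp add: U_def)
    with \<open>U \<noteq> 0\<close> show False ..
  qed
  then have U: "order b U mod Q < m"
    using sum_scaled_powers_nonzero[of m Q J A b] A by (simp add: U_def Q)
  have "\<exists>j<J. B j \<noteq> 0"
  proof (rule ccontr)
    assume "\<not> (\<exists>j<J. B j \<noteq> 0)"
    then have "V = 0" by (simp add: V_def)
    with \<open>V \<noteq> 0\<close> show False ..
  qed
  then have V: "order b V mod Q < m"
    using sum_scaled_powers_nonzero[of m Q J B b] B by (simp add: V_def Q)
  have "order b (f ^ n) = n" for n
    using f f0 by (induction n) (auto simp: order_mult)
  then have "2 * order b U + 1 = 2 * order b V + Q"
    using arg_cong[OF eq, of "order b"] \<open>U \<noteq> 0\<close> \<open>V \<noteq> 0\<close> f0 f(1) by (simp add: order_mult)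
  then have "(2 * order b U + 1) mod Q = (2 * order b V) mod Q" by simp
  then have "(2 * (order b U mod Q) + 1) mod Q = (2 * (order b V mod Q)) mod Q"
    by (metis mod_add_left_eq mod_mult_right_eq)
  moreover have "2 * (order b U mod Q) + 1 < Q" "2 * (order b V mod Q) < Q" using U V Q by auto
  ultimately have "2 * (order b U mod Q) + 1 = 2 * (order b V mod Q)" by simp
  then show False by (metis dvd_triv_left even_plus_one_iff)
qed

text \<open>
  For \<open>c\<close> in \<open>C\<close>, which encodes \<open>2 J\<close> polynomials of degree less than \<open>m\<close>, the polynomial \<open>H c\<close> times
  \<open>pcompose f Z ^ l\<close> has a Taylor expansion with coefficients in \<open>E\<close>. The hypothesis on \<open>l\<close> and \<open>J\<close> says that
  \<open>E\<close> is smaller than \<open>C\<close>, so two elements of \<open>C\<close> have the same expansion. The polynomial \<open>H\<close> of their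
  difference is nonzero and divisible by \<open>\<pi> ^ l\<close> for all \<open>\<pi>\<close> in \<open>P\<close>; compare degrees.
\<close>

lemma stepanov_bound:
  fixes A :: "'a::{field,finite} set"
  defines "f \<equiv> \<Prod>a\<in>A. [:-a, 1:]"
  assumes b: "b \<in> A"
    and Q: "Q = CARD('a) ^ k" "Q = 2 * m + 1"
    and P: "finite P" "\<And>\<pi>. \<pi> \<in> P \<Longrightarrow> irreducible \<pi>" "\<And>\<pi>. \<pi> \<in> P \<Longrightarrow> lead_coeff \<pi> = 1"
      "\<And>\<pi>. \<pi> \<in> P \<Longrightarrow> degree \<pi> dvd k" "\<And>\<pi>. \<pi> \<in> P \<Longrightarrow> [f ^ m = of_int \<epsilon>] (mod \<pi>)"
    and \<epsilon>: "\<epsilon> = 1 \<or> \<epsilon> = -1"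
    and l: "l \<le> Q" and small: "l * (J + m + l * card A) < 2 * J * m"
  shows "l * (\<Sum>\<pi>\<in>P. degree \<pi>) \<le> m + m * card A + J * Q"
proof -
  define d where "d = card A"
  define Z where "Z = monom (1::'a) Q"
  define W where "W = [:0, 1:] - Z"
  define R where "R = (\<Prod>P) ^ l"
  define Y where "Y = [:-b, 1:] ^ Q"
  have X: "[:0, 1:] = Z + W" by (simp add: W_def)
  have degf: "degree f = d" unfolding f_def d_def by (subst degree_prod_eq_sum_degree) auto
  have f0: "f \<noteq> 0" by (simp add: f_def)
  have split: "f = [:-b, 1:] * (\<Prod>a\<in>A - {b}. [:-a, 1:])"
    unfolding f_def using b by (intro prod.remove) auto
  have "poly (\<Prod>a\<in>A - {b}. [:-a, 1:]) b \<noteq> 0" by (auto simp: poly_prod)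
  then have "order b (\<Prod>a\<in>A - {b}. [:-a, 1:]) = 0" by (rule order_0I)
  moreover have "order b [:-b, 1:] = 1" using order_power_n_n[of b 1] by simp
  ultimately have ordf: "order b f = 1"
    using f0 order_mult[of "[:-b, 1:]" "\<Prod>a\<in>A - {b}. [:-a, 1:]" b] unfolding split by simp
  have fQ: "f ^ Q = pcompose f Z" unfolding Q(1) Z_def by (rule power_card_power_eq_pcompose)
  have YZ: "Y = pcompose [:-b, 1:] Z" unfolding Y_def Q(1) Z_def by (rule power_card_power_eq_pcompose)
  have prime: "prime_elem \<pi>" if "\<pi> \<in> P" for \<pi>
    using P(2)[OF that] by (rule field_poly_irreducible_imp_prime)
  have "\<Prod>P dvd W"
  proof -
    have "\<pi> ^ 1 dvd W" if \<pi>: "\<pi> \<in> P" for \<pi>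
    proof -
      have "[[:0, 1:] ^ Q = [:0, 1:]] (mod \<pi>)"
        unfolding Q(1) using P(2,4)[OF \<pi>] by (rule cong_power_card_degree)
      then show ?thesis by (simp add: W_def Z_def monom_altdef cong_iff_dvd_diff dvd_diff_commute)
    qed
    from prod_irreducible_power_dvd[OF P(1) P(2) P(3) this] show ?thesis by simp
  qed
  then have RW: "R dvd W ^ l" unfolding R_def by (rule dvd_power_same)
  have odd: "odd Q" using Q(2) by simp
  have res: "[pcompose f Z ^ m = of_int \<epsilon>] (mod R)"
  proof -
    have "\<pi> ^ l dvd (f ^ m - of_int \<epsilon>) ^ Q" if \<pi>: "\<pi> \<in> P" for \<pi>
    proof -
      have "\<pi> dvd f ^ m - of_int \<epsilon>" using P(5)[OF \<pi>] by (simp add: cong_iff_dvd_diff)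
      then show ?thesis using l by (meson dvd_power_same dvd_trans le_imp_power_dvd)
    qed
    then have "R dvd (f ^ m - of_int \<epsilon>) ^ Q"
      unfolding R_def using P(1-3) by - (rule prod_irreducible_power_dvd, auto)
    \<comment> \<open>The \<open>Q\<close>-th power is substitution of \<open>Z\<close> for \<open>X\<close>, so the congruence modulo \<open>\<pi>\<close> lifts to \<open>\<pi> ^ Q\<close>.\<close>
    also have "(f ^ m - of_int \<epsilon>) ^ Q = pcompose f Z ^ m - of_int \<epsilon>"
      using \<epsilon> unfolding Q(1) power_card_power_eq_pcompose
      by (auto simp: Z_def Q(1) pcompose_diff pcompose_add pcompose_power pcompose_1 pcompose_uminus)
    finally show ?thesis by (simp add: cong_iff_dvd_diff)
  qed
  define n where "n = m + J + l * d - 1"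
  define H where "H c = (\<Sum>j<J. (c j + c (J + j) * f ^ m) * Y ^ j)" for c :: "nat \<Rightarrow> 'a poly"
  let ?T = "taylor_bounded R Z W l"
  define C where "C = PiE {..<2 * J} (\<lambda>_. polys_below m :: 'a poly set)"
  define E where "E = PiE {..<l} (\<lambda>_. polys_below (Suc n) :: 'a poly set)"
  have m: "m > 0" using small by (cases m) auto
  have J: "J > 0" using small by (cases J) auto
  have fl: "pcompose f Z ^ l \<in> ?T (l * d)"
    using taylor_bounded_power[OF RW taylor_bounded_pcompose[OF RW, where Z = Z and c = f and n = d], where i = l] degf by simp
  have flm: "pcompose f Z ^ l * f ^ m \<in> ?T (l * d)"
    using taylor_bounded_power_residue[OF RW X _ res, where c = "of_int \<epsilon>"] degf by (simp add: of_int_poly)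
  have HT: "pcompose f Z ^ l * H c \<in> ?T n" if c: "c \<in> C" for c
  proof -
    have cT: "c j \<in> ?T (m - 1)" if "j < 2 * J" for j
    proof (rule taylor_bounded_poly[OF RW X])
      have "c j \<in> polys_below (Suc (m - 1))" using c that m by (auto simp: C_def)
      then show "degree (c j) \<le> m - 1" by (simp add: polys_below_Suc_iff)
    qed
    have YT: "Y ^ j \<in> ?T j" for j
      using taylor_bounded_power[OF RW taylor_bounded_pcompose[OF RW, where Z = Z and c = "[:-b, 1:]" and n = 1], where i = j] by (simp add: YZ)
    have eq: "pcompose f Z ^ l * H c = (\<Sum>j<J. (c j * pcompose f Z ^ l + c (J + j) * (pcompose f Z ^ l * f ^ m)) * Y ^ j)"
      unfolding H_def sum_distrib_left by (intro sum.cong refl) (simp add: algebra_simps)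
    show ?thesis unfolding eq
    proof (rule taylor_bounded_sum[OF RW])
      fix j assume j: "j \<in> {..<J}"
      have "(c j * pcompose f Z ^ l + c (J + j) * (pcompose f Z ^ l * f ^ m)) * Y ^ j \<in> ?T (m - 1 + l * d + j)"
        using j by (intro taylor_bounded_mult[OF RW] taylor_bounded_add[OF RW] fl flm YT cT) auto
      then show "(c j * pcompose f Z ^ l + c (J + j) * (pcompose f Z ^ l * f ^ m)) * Y ^ j \<in> ?T n"
        by (rule taylor_bounded_mono[OF RW]) (use j m in \<open>auto simp: n_def\<close>)
    qed
  qed
  have "\<exists>e\<in>E. [pcompose f Z ^ l * H c = (\<Sum>i<l. W ^ i * pcompose (e i) Z)] (mod R)" if c: "c \<in> C" for c
  proof -
    from HT[OF c] obtain e where e: "\<And>i. i < l \<Longrightarrow> e i \<in> polys_below (Suc n)"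
      "[pcompose f Z ^ l * H c = (\<Sum>i<l. W ^ i * pcompose (e i) Z)] (mod R)"
      by (auto simp: taylor_bounded_def)
    have "restrict e {..<l} \<in> E" using e(1) by (auto simp: E_def)
    moreover have "(\<Sum>i<l. W ^ i * pcompose (e i) Z) = (\<Sum>i<l. W ^ i * pcompose (restrict e {..<l} i) Z)"
      by (intro sum.cong) auto
    ultimately show ?thesis using e(2) by (intro bexI[of _ "restrict e {..<l}"]) (simp only:)
  qed
  then obtain \<tau> where \<tau>: "\<And>c. c \<in> C \<Longrightarrow> \<tau> c \<in> E"
    "\<And>c. c \<in> C \<Longrightarrow> [pcompose f Z ^ l * H c = (\<Sum>i<l. W ^ i * pcompose (\<tau> c i) Z)] (mod R)"
    by metis
  \<comment> \<open>Each \<open>c\<close> in \<open>C\<close> now has an expansion \<open>\<tau> c\<close> in \<open>E\<close>; by counting, two of them coincide.\<close>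
  have "card E = CARD('a) ^ (l * (J + m + l * d))"
    using m by (simp add: E_def card_PiE card_polys_below n_def power_mult[symmetric] mult.commute add_ac)
  also have "\<dots> < CARD('a) ^ (2 * J * m)"
    using small card_field_ge_2[where 'a='a] by (intro power_strict_increasing) (auto simp: d_def)
  also have "\<dots> = card C"
    by (simp add: C_def card_PiE card_polys_below power_mult[symmetric] mult_ac)
  finally have "card E < card C" .
  moreover have "finite E" by (simp add: E_def card_polys_below finite_PiE)
  ultimately have "\<not> inj_on \<tau> C" using \<tau>(1) by (metis card_inj_on_le image_subsetI not_le)
  then obtain c c' where cc: "c \<in> C" "c' \<in> C" "c \<noteq> c'" "\<tau> c = \<tau> c'" by (auto simp: inj_on_def)
  define g where "g = (\<lambda>j. c j - c' j)"
  have Hg: "H g = H c - H c'" by (simp add: H_def g_def sum_subtractf algebra_simps)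
  have "[pcompose f Z ^ l * H c = pcompose f Z ^ l * H c'] (mod R)"
    using \<tau>(2)[OF cc(1)] \<tau>(2)[OF cc(2)] cc(4) by (metis cong_sym cong_trans)
  then have Rdvd: "R dvd pcompose f Z ^ l * H g"
    by (simp add: Hg cong_iff_dvd_diff right_diff_distrib)
  have gm: "g j \<in> polys_below m" if "j < 2 * J" for j
    using cc(1,2) that by (auto simp: g_def C_def PiE_def Pi_def polys_below_def)
  obtain j0 where "j0 < 2 * J" "g j0 \<noteq> 0"
    using cc(1-3) by (auto simp: g_def C_def PiE_def extensional_def fun_eq_iff) metis
  then have "\<exists>j<J. g j \<noteq> 0 \<or> g (J + j) \<noteq> 0"
  proof (cases "j0 < J")
    case False
    with \<open>j0 < 2 * J\<close> \<open>g j0 \<noteq> 0\<close> show ?thesis by (intro exI[of _ "j0 - J"]) simp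
  qed auto
  then have H0: "H g \<noteq> 0"
    unfolding H_def Y_def by (intro stepanov_auxiliary_nonzero[OF Q(2) f0 ordf fQ] gm) auto
  have "\<pi> ^ l dvd H g" if \<pi>: "\<pi> \<in> P" for \<pi>
  proof (rule prime_elem_power_dvd_cancel[OF prime[OF \<pi>]])
    have "\<pi> ^ l dvd R" unfolding R_def using P(1) \<pi> by (intro dvd_power_same) auto
    then show "\<pi> ^ l dvd pcompose f Z ^ l * H g" using Rdvd by (rule dvd_trans)
    show "\<not> \<pi> dvd pcompose f Z ^ l"
    proof
      assume "\<pi> dvd pcompose f Z ^ l"
      then have "\<pi> dvd f" unfolding fQ[symmetric] using prime[OF \<pi>] by (metis prime_elem_dvd_power)
      then have "\<pi> dvd f ^ m" using m by (meson dvd_power dvd_trans)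
      moreover have "\<pi> dvd f ^ m - of_int \<epsilon>" using P(5)[OF \<pi>] by (simp add: cong_iff_dvd_diff)
      ultimately have "\<pi> dvd of_int \<epsilon>" by (metis dvd_diff_right_iff)
      then show False using \<epsilon> prime[OF \<pi>] by (auto simp: prime_elem_def)
    qed
  qed
  then have "R dvd H g"
    unfolding R_def using P(1-3) by - (rule prod_irreducible_power_dvd, auto)
  then have "degree R \<le> degree (H g)" using H0 by (rule dvd_imp_degree_le)
  moreover have "degree R = l * (\<Sum>\<pi>\<in>P. degree \<pi>)"
  proof -
    have nz: "\<pi> \<noteq> 0" if "\<pi> \<in> P" for \<pi> using P(2)[OF that] by auto
    then have "\<Prod>P \<noteq> 0" using P(1) by simp
    moreover have "degree (\<Prod>P) = (\<Sum>\<pi>\<in>P. degree \<pi>)" using nz by (subst degree_prod_eq_sum_degree) auto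
    ultimately show ?thesis by (simp add: R_def degree_power_eq)
  qed
  moreover have "degree (H g) \<le> m + m * d + J * Q"
    unfolding H_def
  proof (rule degree_sum_le)
    fix j assume j: "j \<in> {..<J}"
    have dg: "degree (g i) \<le> m" if "i < 2 * J" for i using gm[OF that] by (auto simp: polys_below_eq)
    have "degree (f ^ m) \<le> m * d" using degree_power_le[of f m] degf by (simp add: mult.commute)
    then have "degree (g (J + j) * f ^ m) \<le> m + m * d"
      using degree_mult_le[of "g (J + j)" "f ^ m"] dg[of "J + j"] j by simp
    then have "degree (g j + g (J + j) * f ^ m) \<le> m + m * d"
      using dg[of j] j by (intro degree_add_le) auto
    moreover have "degree (Y ^ j) \<le> J * Q"
    proof -
      have "degree (Y ^ j) = j * Q" by (simp add: Y_def degree_power_eq mult.commute)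
      also have "\<dots> \<le> J * Q" using j by (intro mult_right_mono) auto
      finally show ?thesis .
    qed
    ultimately show "degree ((g j + g (J + j) * f ^ m) * Y ^ j) \<le> m + m * d + J * Q"
      using degree_mult_le[of "g j + g (J + j) * f ^ m" "Y ^ j"] by linarith
  qed simp
  ultimately show ?thesis by (simp add: d_def)
qed

text \<open>
  A monic irreducible polynomial with the root \<open>a\<close> is \<open>X - a\<close>.
\<close>

lemma sum_degree_irreducibles_with_root_le:
  fixes A :: "'a::field set" and P :: "'a poly set"
  assumes "finite A" "\<And>\<pi>. \<pi> \<in> P \<Longrightarrow> irreducible \<pi> \<and> lead_coeff \<pi> = 1 \<and> (\<exists>a\<in>A. poly \<pi> a = 0)"
  shows "(\<Sum>\<pi>\<in>P. degree \<pi>) \<le> card A"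
proof -
  have sub: "P \<subseteq> (\<lambda>a. [:-a, 1:]) ` A"
  proof
    fix \<pi> assume "\<pi> \<in> P"
    then obtain a where a: "irreducible \<pi>" "lead_coeff \<pi> = 1" "a \<in> A" "poly \<pi> a = 0" using assms(2) by blast
    then have "[:-a, 1:] dvd \<pi>" by (simp add: poly_eq_0_iff_dvd)
    then have "[:-a, 1:] = \<pi>"
      using a irreducible_linear_field_poly[of 1 "-a"] by (intro monic_irreducible_dvd_eq) auto
    with a(3) show "\<pi> \<in> (\<lambda>a. [:-a, 1:]) ` A" by auto
  qed
  have "(\<Sum>\<pi>\<in>P. degree \<pi>) = (\<Sum>\<pi>\<in>P. 1)"
    using sub by (intro sum.cong) auto
  also have "\<dots> \<le> card ((\<lambda>a. [:-a, 1:]) ` A)"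
    using card_mono[OF _ sub] assms(1) by simp
  also have "\<dots> \<le> card A" using assms(1) by (rule card_image_le)
  finally show ?thesis .
qed

text \<open>
  With \<open>Q = 2 * m + 1\<close>, the optimal \<open>l\<close> is of size \<open>sqrt Q\<close>. The excess \<open>4 * d + 3\<close> of \<open>2 * J\<close> over \<open>l\<close> is large
  enough for the inequality, and odd so that \<open>J\<close> exists for odd \<open>l\<close>.
\<close>

lemma stepanov_parameters:
  fixes l m d :: nat
  assumes "l \<ge> 3" "l * l \<le> 2 * m + 1" "2 * J = l + 4 * d + 3"
  shows "l * (J + m + l * d) < 2 * J * m"
proof -
  have "3 * l \<le> 2 * m + 1" using mult_le_mono1[OF assms(1), of l] assms(2) by linarith
  then have *: "(3 * l) * (4 * d + 3) \<le> (2 * m + 1) * (4 * d + 3)" by (rule mult_le_mono1)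
  have m: "m \<ge> 4" using \<open>3 * l \<le> 2 * m + 1\<close> assms(1) by linarith
  have "(l * l) * (1 + 2 * d) \<le> (2 * m + 1) * (1 + 2 * d)" using assms(2) by (rule mult_le_mono1)
  then have 1: "l * l + 2 * (d * l * l) \<le> 2 * m + 1 + 4 * (d * m) + 2 * d" by (simp add: algebra_simps)
  have 2: "12 * (d * l) + 9 * l \<le> 8 * (d * m) + 6 * m + 4 * d + 3" using * by (simp add: algebra_simps)
  have 3: "4 * d \<le> d * m" using mult_le_mono2[OF m, of d] by simp
  have "l * (l + 4 * d + 3) + 2 * (l * m) + 2 * (l * l * d)
      = l * l + 4 * (d * l) + 3 * l + 2 * (l * m) + 2 * (d * l * l)"
    by (simp add: algebra_simps)
  moreover have "2 * ((l + 4 * d + 3) * m) = 2 * (l * m) + 8 * (d * m) + 6 * m" by (simp add: algebra_simps)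
  ultimately have "l * (l + 4 * d + 3) + 2 * (l * m) + 2 * (l * l * d) < 2 * ((l + 4 * d + 3) * m)"
    using 1 2 3 m by linarith
  moreover have "2 * (l * (J + m + l * d)) = l * (2 * J) + 2 * (l * m) + 2 * (l * l * d)"
    by (simp add: algebra_simps)
  moreover have "2 * (2 * J * m) = 2 * ((2 * J) * m)" by simp
  ultimately have "2 * (l * (J + m + l * d)) < 2 * (2 * J * m)" by (simp only: assms(3))
  then show ?thesis by simp
qed

text \<open>
  The prime powers of degree \<open>k\<close> correspond to the irreducible polynomials whose degree divides \<open>k\<close>.
  Their total degree is \<open>Q = q ^ k\<close>. Those with character \<open>0\<close> have total degree at most \<open>card A\<close>, so upper
  bounds for the two classes with character \<open>1\<close> and \<open>-1\<close> bound the difference of their total degrees from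
  both sides. The case \<open>k = 1\<close>, where \<open>l\<close> below would be \<open>1\<close>, is covered by the trivial bound.
\<close>

lemma prime_power_sum_bound:
  fixes A :: "'a::{field,finite} set"
  assumes odd: "odd CARD('a)" and A: "A \<noteq> {}" and k: "k \<ge> 1"
  defines "C \<equiv> (5 * real (card A) + 4) * real CARD('a) + real (card A)"
  shows "\<bar>real_of_int (prime_power_sum (poly_char A) k)\<bar> \<le> C * sqrt CARD('a) ^ k"
proof -
  define q where "q = CARD('a)"
  define d where "d = card A"
  define Q where "Q = q ^ k"
  define m where "m = (Q - 1) div 2"
  define PA where "PA = {\<pi> :: 'a poly. irreducible \<pi> \<and> lead_coeff \<pi> = 1 \<and> degree \<pi> dvd k}"
  define v where "v \<pi> = poly_char A \<pi> ^ (k div degree \<pi>)" for \<pi> :: "'a poly"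
  have q: "q \<ge> 3" using card_field_ge_2[where 'a='a] odd by (cases "q = 2") (auto simp: q_def)
  have Q: "Q = 2 * m + 1" using odd by (auto simp: m_def Q_def q_def elim!: oddE)
  have bij: "bij_betw (\<lambda>\<pi>. (\<pi>, k div degree \<pi>)) PA (prime_powers_of_degree k)"
  proof (rule bij_betwI')
    fix \<pi> assume \<pi>: "\<pi> \<in> PA"
    then have "degree \<pi> > 0" by (auto simp: PA_def intro: irreducible_poly_degree_pos)
    then show "(\<pi>, k div degree \<pi>) \<in> prime_powers_of_degree k"
      using \<pi> k by (auto simp: PA_def prime_powers_of_degree_def elim!: dvdE)
  next
    fix y :: "'a poly \<times> nat" assume y: "y \<in> prime_powers_of_degree k"
    obtain \<pi> r where yr: "y = (\<pi>, r)" by (cases y)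
    then have "degree \<pi> > 0" using y by (auto simp: prime_powers_of_degree_def intro: irreducible_poly_degree_pos)
    then show "\<exists>\<pi>\<in>PA. y = (\<pi>, k div degree \<pi>)"
      using y by (auto simp: yr PA_def prime_powers_of_degree_def)
  qed auto
  have finPA: "finite PA" using bij_betw_finite[OF bij] finite_prime_powers_of_degree by blast
  have S: "prime_power_sum (poly_char A) k = (\<Sum>\<pi>\<in>PA. int (degree \<pi>) * v \<pi>)"
    unfolding prime_power_sum_def
    using sum.reindex_bij_betw[OF bij, of "\<lambda>(\<pi>, r). int (degree \<pi>) * poly_char A \<pi> ^ r"] by (simp add: v_def)
  have total: "(\<Sum>\<pi>\<in>PA. degree \<pi>) = Q"
  proof -
    have "(\<Sum>\<pi>\<in>PA. int (degree \<pi>)) = int CARD('a) ^ k"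
      using sum.reindex_bij_betw[OF bij, of "\<lambda>(\<pi>, r). int (degree \<pi>)"] sum_degrees_prime_powers[OF k, where 'a='a]
      by simp
    then have "int (\<Sum>\<pi>\<in>PA. degree \<pi>) = int Q" by (simp add: Q_def q_def)
    then show ?thesis by (simp only: of_nat_eq_iff)
  qed
  define N where "N \<epsilon> = (\<Sum>\<pi>\<in>{\<pi> \<in> PA. v \<pi> = \<epsilon>}. degree \<pi>)" for \<epsilon>
  have v: "v \<pi> \<in> {1, -1, 0}" for \<pi>
    using poly_char_cases[of A \<pi>] by (auto simp: v_def minus_one_power_iff power_0_left split: if_splits)
  have split: "(\<Sum>\<pi>\<in>PA. g \<pi>) = (\<Sum>\<pi>\<in>{\<pi> \<in> PA. v \<pi> = 1}. g \<pi>)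
      + (\<Sum>\<pi>\<in>{\<pi> \<in> PA. v \<pi> = -1}. g \<pi>) + (\<Sum>\<pi>\<in>{\<pi> \<in> PA. v \<pi> = 0}. g \<pi>)" for g :: "'a poly \<Rightarrow> int"
  proof -
    have "PA = ({\<pi> \<in> PA. v \<pi> = 1} \<union> {\<pi> \<in> PA. v \<pi> = -1}) \<union> {\<pi> \<in> PA. v \<pi> = 0}" using v by blast
    then have "(\<Sum>\<pi>\<in>PA. g \<pi>) = (\<Sum>\<pi>\<in>({\<pi> \<in> PA. v \<pi> = 1} \<union> {\<pi> \<in> PA. v \<pi> = -1}) \<union> {\<pi> \<in> PA. v \<pi> = 0}. g \<pi>)"
      by (rule arg_cong)
    also have "\<dots> = (\<Sum>\<pi>\<in>{\<pi> \<in> PA. v \<pi> = 1} \<union> {\<pi> \<in> PA. v \<pi> = -1}. g \<pi>) + (\<Sum>\<pi>\<in>{\<pi> \<in> PA. v \<pi> = 0}. g \<pi>)"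
      using finPA by (intro sum.union_disjoint) auto
    also have "(\<Sum>\<pi>\<in>{\<pi> \<in> PA. v \<pi> = 1} \<union> {\<pi> \<in> PA. v \<pi> = -1}. g \<pi>)
        = (\<Sum>\<pi>\<in>{\<pi> \<in> PA. v \<pi> = 1}. g \<pi>) + (\<Sum>\<pi>\<in>{\<pi> \<in> PA. v \<pi> = -1}. g \<pi>)"
      using finPA by (intro sum.union_disjoint) auto
    finally show ?thesis .
  qed
  have SN: "prime_power_sum (poly_char A) k = int (N 1) - int (N (-1))"
    unfolding S split by (simp add: N_def sum_negf)
  have QN: "int Q = int (N 1) + int (N (-1)) + int (N 0)"
    using split[of "\<lambda>\<pi>. int (degree \<pi>)"] by (simp add: N_def flip: total)
  have N0: "N 0 \<le> d"
    unfolding N_def d_def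
  proof (rule sum_degree_irreducibles_with_root_le)
    fix \<pi> assume \<pi>: "\<pi> \<in> {\<pi> \<in> PA. v \<pi> = 0}"
    then have "poly_char A \<pi> = 0" by (simp add: v_def)
    then have "\<exists>a\<in>A. poly \<pi> a = 0" by (auto simp: poly_char_def)
    with \<pi> show "irreducible \<pi> \<and> lead_coeff \<pi> = 1 \<and> (\<exists>a\<in>A. poly \<pi> a = 0)" by (auto simp: PA_def)
  qed simp
  have s: "sqrt q ^ k \<ge> 1" using q by (intro one_le_power) simp
  have ss: "sqrt q ^ k * sqrt q ^ k = Q" by (simp add: Q_def flip: power_mult_distrib)
  have C0: "C = (5 * real d + 4) * q + d" by (simp add: C_def d_def q_def)
  show ?thesis
  proof (cases "k = 1")
    case True
    have "\<bar>real_of_int (prime_power_sum (poly_char A) k)\<bar> \<le> real Q"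
    proof -
      have "\<bar>prime_power_sum (poly_char A) k\<bar> \<le> int Q" using SN QN by linarith
      then show ?thesis by linarith
    qed
    also have "\<dots> = 1 * real q * 1" by (simp add: Q_def True)
    also have "\<dots> \<le> (5 * real d + 4) * q * sqrt q ^ k" using s by (intro mult_mono) auto
    also have "\<dots> \<le> C * sqrt q ^ k" unfolding C0 by (intro mult_right_mono) auto
    finally show ?thesis by (simp add: q_def)
  next
    case False
    \<comment> \<open>For odd \<open>k\<close> this falls short of \<open>sqrt Q\<close> by the factor \<open>sqrt q\<close>, which only affects the constant.\<close>
    define l where "l = q ^ (k div 2)"
    have k2: "k div 2 \<ge> 1" using False k by simp
    have "q ^ 1 \<le> l" unfolding l_def using q k2 by (intro power_increasing) auto
    then have l3: "l \<ge> 3" using q by simp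
    have ll: "l * l \<le> Q" "Q \<le> q * (l * l)"
    proof -
      have "l * l = q ^ (k div 2 + k div 2)" by (simp add: l_def power_add)
      then have e: "l * l = q ^ (k div 2 + k div 2)" "q * (l * l) = q ^ (k div 2 + k div 2 + 1)" by simp_all
      show "l * l \<le> Q" unfolding e(1) Q_def using q by (intro power_increasing) simp_all
      show "Q \<le> q * (l * l)" unfolding e(2) Q_def using q by (intro power_increasing) simp_all
    qed
    obtain J where J: "2 * J = l + 4 * d + 3"
    proof -
      have "odd l" using odd by (simp add: l_def q_def)
      then have "even (l + 4 * d + 3)" by simp
      with that show ?thesis by (elim evenE) auto
    qed
    have small: "l * (J + m + l * d) < 2 * J * m"
      using l3 ll(1) J unfolding Q by (rule stepanov_parameters)
    obtain b where b: "b \<in> A" using A by auto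
    have N: "2 * real (N \<epsilon>) - real Q \<le> (5 * real d + 4) * q * l" if \<epsilon>: "\<epsilon> = 1 \<or> \<epsilon> = -1" for \<epsilon>
    proof -
      have "l * N \<epsilon> \<le> m + m * card A + J * Q"
        unfolding N_def
      proof (rule stepanov_bound[OF b Q_def[unfolded q_def] Q _ _ _ _ _ \<epsilon>])
        show "finite {\<pi> \<in> PA. v \<pi> = \<epsilon>}" using finPA by simp
        show "l \<le> Q" using ll(1) l3 by (meson le_trans le_square)
        show "l * (J + m + l * card A) < 2 * J * m" using small by (simp add: d_def)
        fix \<pi> assume \<pi>: "\<pi> \<in> {\<pi> \<in> PA. v \<pi> = \<epsilon>}"
        then show *: "irreducible \<pi>" "lead_coeff \<pi> = 1" "degree \<pi> dvd k" by (auto simp: PA_def)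
        have "k = degree \<pi> * (k div degree \<pi>)" "k div degree \<pi> > 0"
          using *(3) k irreducible_poly_degree_pos[OF *(1)] by (auto elim!: dvdE)
        then have "[(\<Prod>a\<in>A. [:-a, 1:]) ^ m = of_int (v \<pi>)] (mod \<pi>)"
          unfolding m_def Q_def q_def v_def by (rule euler_criterion_poly[OF odd *(1,2)])
        then show "[(\<Prod>a\<in>A. [:-a, 1:]) ^ m = of_int \<epsilon>] (mod \<pi>)"
          using \<pi> by simp
      qed
      then have "2 * (l * N \<epsilon>) \<le> 2 * m + 2 * m * d + (2 * J) * Q" by (simp add: d_def)
      also have "\<dots> \<le> Q + Q * d + (l + 4 * d + 3) * Q" unfolding J by (simp add: Q)
      also have "\<dots> = l * Q + (5 * d + 4) * Q" by (simp add: algebra_simps)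
      also have "\<dots> \<le> l * Q + (5 * d + 4) * (q * (l * l))" using ll(2) by (intro add_left_mono mult_left_mono) auto
      also have "\<dots> = l * (Q + (5 * d + 4) * q * l)" by (simp add: algebra_simps)
      finally have "l * (2 * N \<epsilon>) \<le> l * (Q + (5 * d + 4) * q * l)" by (simp add: mult.left_commute)
      then have "2 * N \<epsilon> \<le> Q + (5 * d + 4) * q * l" using l3 by simp
      then have "real (2 * N \<epsilon>) \<le> real (Q + (5 * d + 4) * q * l)" by (simp only: of_nat_le_iff)
      then show ?thesis by simp
    qed
    have "real l * real l \<le> sqrt q ^ k * sqrt q ^ k" using ll(1) unfolding ss by (simp flip: of_nat_mult)
    then have ls: "real l \<le> sqrt q ^ k"
      using power2_le_imp_le[of "real l" "sqrt q ^ k"] s by (simp add: power2_eq_square)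
    have "\<bar>real_of_int (prime_power_sum (poly_char A) k)\<bar> \<le> (5 * real d + 4) * q * l + d"
    proof -
      have "real_of_int (prime_power_sum (poly_char A) k) = real (N 1) - real (N (-1))"
        unfolding SN by simp
      moreover have "real Q = real (N 1) + real (N (-1)) + real (N 0)" using QN by linarith
      moreover have "real (N 0) \<le> real d" using N0 by simp
      ultimately show ?thesis using N[of 1] N[of "-1"] by (simp add: abs_le_iff)
    qed
    also have "\<dots> \<le> (5 * real d + 4) * q * sqrt q ^ k + d * sqrt q ^ k"
      using ls s mult_left_mono[OF s, of "real d"] by (intro add_mono mult_left_mono) auto
    also have "\<dots> = C * sqrt q ^ k" by (simp add: C0 algebra_simps)
    finally show ?thesis by (simp add: q_def)
  qed
qed

section \<open>Zeros of a polynomial from its Newton identities\<close>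

text \<open>
  The linear coefficient is minus the sum of the inverse roots; split them off one at a time.
\<close>

lemma coeff_1_bound_of_roots:
  fixes P :: "complex poly"
  assumes "s > 0" "coeff P 0 = 1" "\<And>z. poly P z = 0 \<Longrightarrow> norm z \<ge> 1 / s"
  shows "norm (coeff P 1) \<le> real (degree P) * s"
  using assms(2,3)
proof (induction "degree P" arbitrary: P)
  case 0
  then show ?case by (simp add: coeff_eq_0)
next
  case (Suc n)
  have "\<not> constant (poly P)" using Suc.hyps(2) by (simp add: constant_degree)
  then obtain z where z: "poly P z = 0" using fundamental_theorem_of_algebra by blast
  have z0: "z \<noteq> 0" using z Suc.prems(1) by (auto simp: poly_0_coeff_0)
  from z obtain Q where Q: "P = [:-z, 1:] * Q" by (auto simp: poly_eq_0_iff_dvd elim: dvdE)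
  define R where "R = smult (-z) Q"
  have lin: "[:-z, 1:] = smult (-z) [:1, - 1 / z:]" using z0 by simp
  have P: "P = [:1, - 1 / z:] * R" unfolding Q R_def lin mult_smult_left mult_smult_right ..
  have R0: "coeff R 0 = 1" using Suc.prems(1) by (simp add: P)
  have "R \<noteq> 0" using R0 by auto
  then have deg: "degree P = Suc (degree R)" using z0 unfolding P by (subst degree_mult_eq) auto
  have "norm (coeff R 1) \<le> real (degree R) * s"
  proof (rule Suc.hyps(1))
    show "n = degree R" using Suc.hyps(2) deg by simp
    show "norm w \<ge> 1 / s" if "poly R w = 0" for w
      using that by (intro Suc.prems(2)) (simp add: P)
  qed fact
  moreover have "norm (1 / z) \<le> s"
    using Suc.prems(2)[OF z] z0 assms(1) by (simp add: norm_divide field_simps)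
  moreover have "coeff P 1 = coeff R 1 - 1 / z"
    using R0 by (simp add: P coeff_pCons_Suc coeff_pCons)
  ultimately have "norm (coeff P 1) \<le> real (degree R) * s + s"
    using norm_triangle_ineq4[of "coeff R 1" "1 / z"] by simp
  then show ?case by (simp add: deg algebra_simps)
qed

text \<open>
  The Newton identities say \<open>P * F = w * P'\<close> for the power series \<open>F\<close> with coefficients \<open>\<sigma>\<close>, which is
  continuous on the disc of radius \<open>1 / s\<close>. A root \<open>z\<close> of \<open>P\<close> in the disc, of order \<open>k\<close>, would be a root
  of order at least \<open>k\<close> of the left-hand side, but only of order \<open>k - 1\<close> of \<open>w * P'\<close>, since \<open>z \<noteq> 0\<close>.
\<close>

lemma no_small_root:
  fixes P :: "complex poly" and \<sigma> :: "nat \<Rightarrow> complex"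
  assumes s: "s > 0"
    and P0: "coeff P 0 = 1"
    and newton: "\<And>m. of_nat m * coeff P m = (\<Sum>n\<le>m. \<sigma> n * coeff P (m - n))"
    and bound: "\<And>n. norm (\<sigma> n) \<le> C * s ^ n"
    and z: "poly P z = 0"
  shows "norm z \<ge> 1 / s"
proof (rule ccontr)
  assume "\<not> norm z \<ge> 1 / s"
  then have zs: "norm z < 1 / s" by simp
  have P: "P \<noteq> 0" using P0 by auto
  have z0: "z \<noteq> 0" using z P0 by (auto simp: poly_0_coeff_0)
  define F where "F w = (\<Sum>n. \<sigma> n * w ^ n)" for w
  have sumF: "summable (\<lambda>n. norm (\<sigma> n * w ^ n))" if "norm w < 1 / s" for w
  proof (rule summable_comparison_test')
    have "s * norm w < 1" using that s by (simp add: field_simps)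
    then show "summable (\<lambda>n. C * (s * norm w) ^ n)"
      using s by (intro summable_mult summable_geometric) (simp add: abs_mult)
    fix n :: nat assume "n \<ge> 0"
    have "norm (norm (\<sigma> n * w ^ n)) = norm (\<sigma> n) * norm w ^ n" by (simp add: norm_mult norm_power)
    also have "\<dots> \<le> C * s ^ n * norm w ^ n" by (intro mult_right_mono bound) simp
    finally show "norm (norm (\<sigma> n * w ^ n)) \<le> C * (s * norm w) ^ n"
      by (simp add: power_mult_distrib mult.assoc)
  qed
  have polyP: "poly P w = (\<Sum>n. coeff P n * w ^ n)" "summable (\<lambda>n. norm (coeff P n * w ^ n))" for w
  proof -
    show "poly P w = (\<Sum>n. coeff P n * w ^ n)"
      unfolding poly_altdef by (rule suminf_finite[symmetric]) (auto simp: coeff_eq_0)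
    show "summable (\<lambda>n. norm (coeff P n * w ^ n))"
      by (rule summable_finite[of "{..degree P}"]) (auto simp: coeff_eq_0)
  qed
  have pder: "w * poly (pderiv P) w = (\<Sum>m. of_nat m * coeff P m * w ^ m)" for w
  proof -
    have "w * poly (pderiv P) w = (\<Sum>m\<le>degree P. of_nat m * coeff P m * w ^ m)"
    proof -
      have "pderiv P = pderiv (\<Sum>m\<le>degree P. monom (coeff P m) m)" by (simp add: poly_as_sum_of_monoms)
      also have "\<dots> = (\<Sum>m\<le>degree P. monom (of_nat m * coeff P m) (m - 1))"
      proof -
        have "pderiv (sum f M) = (\<Sum>m\<in>M. pderiv (f m))" for f :: "nat \<Rightarrow> complex poly" and M
          by (induction M rule: infinite_finite_induct) (simp_all add: pderiv_add)
        then show ?thesis by (simp add: pderiv_monom)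
      qed
      finally have "w * poly (pderiv P) w = (\<Sum>m\<le>degree P. of_nat m * coeff P m * (w * w ^ (m - 1)))"
        by (simp add: poly_sum poly_monom sum_distrib_left mult_ac)
      also have "\<dots> = (\<Sum>m\<le>degree P. of_nat m * coeff P m * w ^ m)"
      proof (intro sum.cong refl)
        fix m show "of_nat m * coeff P m * (w * w ^ (m - 1)) = of_nat m * coeff P m * w ^ m"
          by (cases m) auto
      qed
      finally show ?thesis .
    qed
    also have "\<dots> = (\<Sum>m. of_nat m * coeff P m * w ^ m)"
      by (rule suminf_finite[symmetric]) (auto simp: coeff_eq_0)
    finally show ?thesis .
  qed
  \<comment> \<open>Both sides are power series in \<open>w\<close>; the Newton identities equate their coefficients.\<close>
  have eq: "poly P w * F w = w * poly (pderiv P) w" if "norm w < 1 / s" for w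
  proof -
    have "F w * poly P w = (\<Sum>m. \<Sum>n\<le>m. (\<sigma> n * w ^ n) * (coeff P (m - n) * w ^ (m - n)))"
      unfolding F_def polyP(1) by (rule Cauchy_product[OF sumF[OF that] polyP(2)])
    also have "\<dots> = (\<Sum>m. of_nat m * coeff P m * w ^ m)"
    proof (rule suminf_cong)
      fix m
      have "(\<sigma> n * w ^ n) * (coeff P (m - n) * w ^ (m - n)) = \<sigma> n * coeff P (m - n) * w ^ m" if "n \<le> m" for n
      proof -
        have "w ^ m = w ^ n * w ^ (m - n)" using that by (simp flip: power_add)
        then show ?thesis by simp
      qed
      then have "(\<Sum>n\<le>m. (\<sigma> n * w ^ n) * (coeff P (m - n) * w ^ (m - n))) = (\<Sum>n\<le>m. \<sigma> n * coeff P (m - n) * w ^ m)"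
        by (intro sum.cong[OF refl]) (metis atMost_iff)
      then show "(\<Sum>n\<le>m. (\<sigma> n * w ^ n) * (coeff P (m - n) * w ^ (m - n))) = of_nat m * coeff P m * w ^ m"
        by (simp only: newton sum_distrib_right)
    qed
    finally show ?thesis by (simp add: pder mult.commute)
  qed
  define k where "k = order z P"
  have k: "k > 0" using z P by (simp add: k_def order_gt_0_iff)
  obtain Q where Q: "P = [:-z, 1:] ^ k * Q" "poly Q z \<noteq> 0"
    using order_decomp[OF P, of z] by (auto simp: k_def poly_eq_0_iff_dvd)
  \<comment> \<open>The difference of the two sides, divided by \<open>(w - z) ^ (k - 1)\<close>.\<close>
  define G where "G w = (w - z) * poly Q w * F w - w * (of_nat k * poly Q w + (w - z) * poly (pderiv Q) w)" for w
  have G0: "G w = 0" if w: "norm w < 1 / s" "w \<noteq> z" for w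
  proof -
    obtain k' where k': "k = Suc k'" using k by (cases k) auto
    have P': "P = [:-z, 1:] ^ k' * ([:-z, 1:] * Q)" by (simp only: Q(1) k' power_Suc mult_ac)
    have "pderiv P = [:-z, 1:] ^ k' * (of_nat k * Q + [:-z, 1:] * pderiv Q)"
    proof -
      define L where "L = [:-z, 1:]"
      have "pderiv L = 1" by (simp add: L_def pderiv_pCons)
      then have "pderiv (L ^ k * Q) = smult (of_nat k) (L ^ k') * Q + L ^ k * pderiv Q"
        unfolding k' pderiv_mult pderiv_power_Suc by (simp add: mult.commute add.commute)
      also have "\<dots> = L ^ k' * (smult (of_nat k) Q + L * pderiv Q)"
        by (simp add: k' distrib_left mult_ac)
      also have "smult (of_nat k) Q = of_nat k * Q" by (simp add: of_nat_poly)
      finally show ?thesis by (simp only: Q(1) L_def)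
    qed
    then have "poly (pderiv P) w = (w - z) ^ k' * (of_nat k * poly Q w + (w - z) * poly (pderiv Q) w)"
      by (simp add: poly_power of_nat_poly left_diff_distrib)
    moreover have "poly P w = (w - z) ^ k' * ((w - z) * poly Q w)"
      unfolding P' by (simp add: poly_power left_diff_distrib)
    ultimately have "(w - z) ^ k' * G w = poly P w * F w - w * poly (pderiv P) w"
      unfolding G_def by (simp only:) (simp add: algebra_simps)
    then have "(w - z) ^ k' * G w = 0" using eq[OF w(1)] by simp
    then show ?thesis using w(2) by simp
  qed
  obtain r where r: "norm z < r" "r < 1 / s" using zs dense by blast
  then have r0: "r > 0" using norm_ge_zero[of z] by linarith
  have "isCont F z"
    unfolding F_def
  proof (rule isCont_powser)
    have "norm (of_real r :: complex) < 1 / s" using r r0 by simp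
    then show "summable (\<lambda>n. \<sigma> n * (of_real r :: complex) ^ n)" by (rule summable_norm_cancel[OF sumF])
    show "norm z < norm (of_real r :: complex)" using r r0 by simp
  qed
  then have "isCont G z" unfolding G_def by (intro continuous_intros)
  then have "(G \<longlongrightarrow> G z) (at z)" by (simp add: isCont_def)
  moreover have "(G \<longlongrightarrow> 0) (at z)"
  proof (rule tendsto_eventually)
    have "open {w. norm w < 1 / s}" by (intro open_Collect_less continuous_intros)
    then have "eventually (\<lambda>w. w \<in> {w. norm w < 1 / s}) (at z)"
      using zs by (intro eventually_at_in_open') auto
    moreover have "eventually (\<lambda>w. w \<noteq> z) (at z)" by (rule eventually_neq_at_within)
    ultimately show "eventually (\<lambda>w. G w = 0) (at z)" by eventually_elim (use G0 in auto)
  qed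
  ultimately have "G z = 0" using tendsto_unique by (metis at_neq_bot)
  then show False using k z0 Q(2) by (simp add: G_def)
qed

lemma linear_coeff_bound_of_newton:
  fixes c \<sigma> :: "nat \<Rightarrow> complex"
  assumes s: "s > 0" and c0: "c 0 = 1" and cD: "\<And>m. m > D \<Longrightarrow> c m = 0"
    and newton: "\<And>m. of_nat m * c m = (\<Sum>n\<in>{1..m}. \<sigma> n * c (m - n))"
    and bound: "\<And>n. n \<ge> 1 \<Longrightarrow> norm (\<sigma> n) \<le> C * s ^ n"
  shows "norm (c 1) \<le> real D * s"
proof -
  define P where "P = (\<Sum>m\<le>D. monom (c m) m)"
  have P: "coeff P m = c m" for m
    using cD[of m] by (auto simp: P_def coeff_sum not_le)
  have degP: "degree P \<le> D" by (rule degree_le) (simp add: P cD)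
  define \<sigma>' where "\<sigma>' = \<sigma>(0 := 0)"
  have "0 \<le> C * s" using order_trans[OF norm_ge_zero bound[of 1]] by simp
  then have C: "C \<ge> 0" using s by (simp add: zero_le_mult_iff)
  have "norm z \<ge> 1 / s" if "poly P z = 0" for z
  proof (rule no_small_root[OF s _ _ _ that])
    show "coeff P 0 = 1" by (simp add: P c0)
    show "norm (\<sigma>' n) \<le> C * s ^ n" for n
      using bound[of n] s C by (cases "n = 0") (auto simp: \<sigma>'_def)
    show "of_nat m * coeff P m = (\<Sum>n\<le>m. \<sigma>' n * coeff P (m - n))" for m
    proof -
      have "(\<Sum>n\<le>m. \<sigma>' n * c (m - n)) = (\<Sum>n\<in>{1..m}. \<sigma>' n * c (m - n))"
        by (rule sum.mono_neutral_right) (auto simp: \<sigma>'_def)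
      also have "\<dots> = (\<Sum>n\<in>{1..m}. \<sigma> n * c (m - n))" by (rule sum.cong) (auto simp: \<sigma>'_def)
      finally show ?thesis by (simp add: P newton)
    qed
  qed
  then have "norm (coeff P 1) \<le> real (degree P) * s"
    by (intro coeff_1_bound_of_roots s) (simp add: P c0)
  also have "\<dots> \<le> real D * s" using degP s by (intro mult_right_mono) auto
  finally show ?thesis by (simp add: P)
qed

section \<open>The Weil bound and the existence of a leaf\<close>

text \<open>
  Weil's bound for the character sum attached to the hyperelliptic curve \<open>y^2 = (\<Prod>a\<in>A. x - a)\<close>.
\<close>

theorem weil_bound_split_polynomial:
  fixes A :: "'a::{field,finite} set"
  assumes odd: "odd CARD('a)" and A: "A \<noteq> {}"
  shows "\<bar>real_of_int (\<Sum>v\<in>UNIV. \<Prod>a\<in>A. quad_char (v - a))\<bar> \<le> real (card A - 1) * sqrt CARD('a)"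
proof -
  define c where "c m = (\<Sum>g\<in>monics m. poly_char A g)" for m
  define \<sigma> where "\<sigma> = prime_power_sum (poly_char A)"
  have "norm (complex_of_int (c 1)) \<le> real (card A - 1) * sqrt CARD('a)"
  proof (rule linear_coeff_bound_of_newton[where c = "\<lambda>m. complex_of_int (c m)" and \<sigma> = "\<lambda>n. complex_of_int (\<sigma> n)"])
    show "sqrt CARD('a) > 0" by simp
    show "complex_of_int (c 0) = 1" by (simp add: c_def sum_poly_char_0)
    show "complex_of_int (c m) = 0" if "m > card A - 1" for m
      using sum_poly_char_eq_0[OF odd A, of m] that by (simp add: c_def)
    show "of_nat m * complex_of_int (c m) = (\<Sum>n\<in>{1..m}. complex_of_int (\<sigma> n) * complex_of_int (c (m - n)))" for m
    proof -
      have "int m * c m = (\<Sum>n\<in>{1..m}. \<sigma> n * c (m - n))"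
        unfolding c_def \<sigma>_def by (rule newton_identity) (simp_all add: poly_char_1 poly_char_mult[OF odd])
      from arg_cong[OF this, of complex_of_int] show ?thesis by simp
    qed
    show "norm (complex_of_int (\<sigma> n)) \<le> ((5 * real (card A) + 4) * real CARD('a) + real (card A)) * sqrt CARD('a) ^ n"
      if "n \<ge> 1" for n
      using prime_power_sum_bound[OF odd A that] by (simp add: \<sigma>_def)
  qed
  then show ?thesis by (simp only: c_def norm_of_int of_int_abs sum_poly_char_1)
qed

text \<open>
  Pair each subset with its complement.
\<close>

lemma sum_card_Pow:
  assumes "finite A"
  shows "2 * (\<Sum>S\<in>Pow A. card S) = card A * 2 ^ card A"
proof -
  have "(\<Sum>S\<in>Pow A. card S) = (\<Sum>S\<in>Pow A. card (A - S))"
    by (rule sum.reindex_bij_witness[of _ "\<lambda>S. A - S" "\<lambda>S. A - S"]) (auto simp: double_diff)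
  then have "2 * (\<Sum>S\<in>Pow A. card S) = (\<Sum>S\<in>Pow A. card S + card (A - S))"
    by (simp add: sum.distrib)
  also have "\<dots> = (\<Sum>S\<in>Pow A. card A)"
    using assms by (intro sum.cong refl) (simp add: card_Diff_subset card_mono finite_subset)
  finally show ?thesis using assms by (simp add: card_Pow)
qed

lemma exists_nonsquare_shifts:
  fixes A :: "'a::{field,finite} set"
  assumes odd: "odd CARD('a)" and A: "A \<noteq> {}"
    and large: "(card A)\<^sup>2 * 2 ^ (2 * card A - 2) < CARD('a)"
  shows "\<exists>v. \<forall>a\<in>A. quad_char (v - a) = -1"
proof (rule ccontr)
  assume neg: "\<nexists>v. \<forall>a\<in>A. quad_char (v - a) = -1"
  define n where "n = card A"
  define s where "s = sqrt (real CARD('a))"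
  define M where "M = real n * 2 ^ (n - 1)"
  define F where "F v = (\<Prod>a\<in>A. 1 - quad_char (v - a))" for v
  have n: "n \<ge> 1" using A by (simp add: n_def Suc_le_eq card_gt_0_iff)
  have Ms: "M < s"
  proof -
    have "M\<^sup>2 = real (n\<^sup>2 * 2 ^ (2 * n - 2))"
      by (simp add: M_def power_mult_distrib right_diff_distrib' mult.commute flip: power_mult)
    also have "\<dots> < real CARD('a)" using large unfolding n_def by (simp only: of_nat_less_iff)
    finally show ?thesis unfolding s_def by (rule real_less_rsqrt)
  qed
  have F: "F v \<le> (if v \<in> A then 2 ^ (n - 1) else 0)" for v
  proof (cases "v \<in> A")
    case True
    have "F v = (\<Prod>a\<in>A - {v}. 1 - quad_char (v - a))"
      unfolding F_def using True by (subst prod.remove[of A v]) auto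
    also have "\<dots> \<le> (\<Prod>a\<in>A - {v}. 2)"
    proof (intro prod_mono conjI)
      fix a show "0 \<le> 1 - quad_char (v - a)" "1 - quad_char (v - a) \<le> 2"
        using quad_char_cases[of "v - a"] by auto
    qed
    also have "\<dots> = 2 ^ (n - 1)" using True by (simp add: n_def card_Diff_singleton_if)
    finally show ?thesis using True by simp
  next
    case False
    obtain a where a: "a \<in> A" "quad_char (v - a) \<noteq> -1" using neg by blast
    then have "v - a \<noteq> 0" using False by auto
    then have "quad_char (v - a) = 1" using a(2) quad_char_cases[of "v - a"] by auto
    then have "F v = 0" unfolding F_def using a(1) by (intro prod_zero) auto
    with False show ?thesis by simp
  qed
  have "(\<Sum>v\<in>UNIV. F v) \<le> (\<Sum>v\<in>UNIV. if v \<in> A then 2 ^ (n - 1) else 0)" by (intro sum_mono F)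
  also have "\<dots> = int n * 2 ^ (n - 1)" by (simp add: sum.If_cases n_def)
  finally have "real_of_int (\<Sum>v\<in>UNIV. F v) \<le> real_of_int (int n * 2 ^ (n - 1))" by (simp only: of_int_le_iff)
  then have upper: "real_of_int (\<Sum>v\<in>UNIV. F v) \<le> M" by (simp add: M_def)
  define T where "T S = (\<Sum>v\<in>UNIV. \<Prod>a\<in>S. quad_char (v - a))" for S :: "'a set"
  \<comment> \<open>The empty set yields the main term \<open>q\<close>, the other subsets are controlled by the Weil bound.\<close>
  have "(\<Sum>v\<in>UNIV. F v) = (\<Sum>v\<in>UNIV. \<Sum>S\<in>Pow A. (-1) ^ card S * (\<Prod>a\<in>S. quad_char (v - a)))"
    unfolding F_def by (intro sum.cong refl) (simp add: prod_diff_conv_sum)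
  also have "\<dots> = (\<Sum>S\<in>Pow A. (-1) ^ card S * T S)"
    unfolding T_def by (subst sum.swap) (simp add: sum_distrib_left)
  also have "\<dots> = int CARD('a) + (\<Sum>S\<in>Pow A - {{}}. (-1) ^ card S * T S)"
    by (subst sum.remove[of _ "{}"]) (auto simp: T_def)
  finally have exp: "real_of_int (\<Sum>v\<in>UNIV. F v)
      = real CARD('a) + (\<Sum>S\<in>Pow A - {{}}. (-1) ^ card S * real_of_int (T S))" by simp
  \<comment> \<open>The gain of \<open>1\<close> over \<open>M\<close>, from replacing \<open>card S\<close> by \<open>card S - 1\<close>, absorbs the contribution of \<open>v \<in> A\<close>.\<close>
  have "(\<Sum>S\<in>Pow A - {{}}. real (card S - 1) * s) \<le> (M - 1) * s"
  proof -
    have "A \<in> Pow A - {{}}" using A by auto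
    have "(\<Sum>S\<in>Pow A - {{}}. real (card S - 1)) + 1 \<le> (\<Sum>S\<in>Pow A - {{}}. real (card S))"
    proof -
      have "(\<Sum>S\<in>Pow A - {{}}. real (card S)) - (\<Sum>S\<in>Pow A - {{}}. real (card S - 1)) = (\<Sum>S\<in>Pow A - {{}}. 1)"
        unfolding sum_subtractf[symmetric]
      proof (intro sum.cong refl)
        fix S assume "S \<in> Pow A - {{}}"
        then have "card S \<ge> 1" by (auto simp: Suc_le_eq card_gt_0_iff)
        then show "real (card S) - real (card S - 1) = 1" by simp
      qed
      moreover have "card (Pow A - {{}}) \<ge> 1"
      proof -
        have "0 < card (Pow A - {{}})"
          by (rule iffD2[OF card_gt_0_iff]) (use \<open>A \<in> Pow A - {{}}\<close> in \<open>auto simp del: Pow_iff\<close>)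
        then show ?thesis by linarith
      qed
      ultimately show ?thesis by simp
    qed
    also have "(\<Sum>S\<in>Pow A - {{}}. real (card S)) = M"
    proof -
      have "(\<Sum>S\<in>Pow A. card S) = n * 2 ^ (n - 1)"
      proof -
        have "(2::nat) ^ n = 2 * 2 ^ (n - 1)" using n by (cases n) auto
        then show ?thesis using sum_card_Pow[of A] by (simp add: n_def)
      qed
      moreover have "(\<Sum>S\<in>Pow A. card S) = (\<Sum>S\<in>Pow A - {{}}. card S)"
        by (subst sum.remove[of _ "{}"]) auto
      ultimately have "real (\<Sum>S\<in>Pow A - {{}}. card S) = real (n * 2 ^ (n - 1))" by simp
      then show ?thesis by (simp add: M_def)
    qed
    finally show ?thesis
      unfolding sum_distrib_right[symmetric] by (intro mult_right_mono) (auto simp: s_def)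
  qed
  moreover have "- (\<Sum>S\<in>Pow A - {{}}. real (card S - 1) * s) \<le> (\<Sum>S\<in>Pow A - {{}}. (-1) ^ card S * real_of_int (T S))"
    unfolding sum_negf[symmetric]
  proof (rule sum_mono)
    fix S assume "S \<in> Pow A - {{}}"
    then have "\<bar>real_of_int (T S)\<bar> \<le> real (card S - 1) * s"
      unfolding T_def s_def using odd by (intro weil_bound_split_polynomial) auto
    moreover have "\<bar>(-1) ^ card S * real_of_int (T S)\<bar> = \<bar>real_of_int (T S)\<bar>"
      by (simp add: abs_mult power_abs)
    ultimately show "- (real (card S - 1) * s) \<le> (-1) ^ card S * real_of_int (T S)" by linarith
  qed
  ultimately have "real CARD('a) - (M - 1) * s \<le> M" using upper exp by linarith
  moreover have "real CARD('a) = s * s" by (simp add: s_def)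
  ultimately have "s * (s - M) + s \<le> M" by (simp add: algebra_simps)
  moreover have "s * (s - M) \<ge> 0" using Ms by (intro mult_nonneg_nonneg) (auto simp: s_def)
  ultimately show False using Ms by linarith
qed

theorem theorem2p2:
  fixes p k q n :: nat
    and a :: "nat \<Rightarrow> 'a::{field,finite}"
  assumes "prime p" and "odd p" and "k \<ge> 1" and "q = p ^ k"
    and "card (UNIV :: 'a set) = q"
    and "[q = 3] (mod 4)"
    and "n \<ge> 1"
    and "n\<^sup>2 * 2 ^ (2 * n - 2) < q"
    and "inj_on a {1..n}"
  shows "\<exists>v. is_leaf (poly_digraph n (\<lambda>i. monom 1 2 + [:a i:])) v"
proof -
  define A where "A = a ` {1..n}"
  have odd: "odd CARD('a)" using assms(2,4,5) by simp
  have card: "card A = n" using assms(9) by (simp add: A_def card_image)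
  have "A \<noteq> {}" using assms(7) by (auto simp: A_def)
  then obtain v where v: "\<And>b. b \<in> A \<Longrightarrow> quad_char (v - b) = -1"
    using exists_nonsquare_shifts[OF odd, of A] assms(5,8) card by auto
  have "u\<^sup>2 + a i \<noteq> v" if i: "i \<in> {1..n}" for u i
  proof
    assume "u\<^sup>2 + a i = v"
    then have "v - a i = u\<^sup>2" by (simp add: algebra_simps)
    moreover have "quad_char (v - a i) = -1" using i by (intro v) (auto simp: A_def)
    ultimately show False using quad_char_square[OF odd, of u] by simp
  qed
  then have "poly (monom 1 2 + [:a i:]) u \<noteq> v" if "i \<in> {1..n}" for u i
    using that by (simp add: poly_monom)
  then have "in_arcs (poly_digraph n (\<lambda>i. monom 1 2 + [:a i:])) v = {}"
    unfolding in_arcs_def poly_digraph_def by fastforce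
  then have "is_leaf (poly_digraph n (\<lambda>i. monom 1 2 + [:a i:])) v"
    by (simp add: is_leaf_def in_degree_def poly_digraph_def)
  then show ?thesis ..
qed

end
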